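(* (Nilpotent Hales--Jewett.) Let $G_\bullet$ be a prefiltration of finite length with $G_0=G$. Assume that $G$ acts on the right on a compact metric space $(X,\rho)$ by homeomorphisms. For every finite subset $A\subset\mathrm{VIP}(G_\bullet)$, every $\varepsilon>0$ and every $H\in\mathcal F$ there exist $N\in\mathcal F$, $N>H$, and a finite set $S\subset G$ such that for every $x\in X$ there exist a non-empty $\alpha\subset N$ and $s\in S$ such that $\rho(xsg(\alpha),xs)<\varepsilon$ for every $g\in A$.
   Context: $\mathbb N=\{0,1,\dots\}$; $\mathcal F_\emptyset$ is the set of finite subsets of $\mathbb N$, $\mathcal F=\mathcal F_\emptyset\setminus\{\emptyset\}$; $\alpha<\beta$ means $\max\alpha<\min\beta$. A prefiltration $G_\bullet$ is a nested sequence of groups $G_0\ge G_1\ge\dots$ with $[G_i,G_j]\subset G_{i+j}$ for all $i,j\in\mathbb N$. It has length $d\in\mathbb N$ if $G_{d+1}$ is trivial, length $-\infty$ if $G_0$ is trivial. $G_{\bullet+1}$ is the prefiltration $(G_{\bullet+1})_i=G_{i+1}$, of length $d-1$ ($-\infty$ if $d=0$). A map $g:\mathcal F_\emptyset\to G_0$ is $G_\bullet$-polynomial if either $d=-\infty$ (and $g$ is identically the identity) or for every $\alpha\in\mathcal F_\emptyset$ there is a $G_{\bullet+1}$-polynomial map $D_\alpha g$ with $D_\alpha g(\beta)=g(\beta)^{-1}g(\alpha\cup\beta)$ for all $\beta\in\mathcal F_\emptyset$ disjoint from $\alpha$. $\mathrm{VIP}(G_\bullet)$ is the group (under pointwise operations)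 of $G_\bullet$-polynomial maps with $g(\emptyset)=1$; its members take values in $G_1$. *)

theory Defs
  imports "HOL-Analysis.Analysis" "HOL-Algebra.Generated_Groups" "HOL-Library.FSet"
begin

(* Finite subsets of the natural numbers, the empty set included, are the elements of the type
   nat fset, so a map defined on all of them is a total function on that type. *)

definition fset_before :: "nat fset \<Rightarrow> nat fset \<Rightarrow> bool" where
  "fset_before \<alpha> \<beta> \<longleftrightarrow> fMax \<alpha> < fMin \<beta>"
  (* only meaningful for non-empty \<alpha> and \<beta> *)

definition commutator_subgroup ::
  "('a, 'b) monoid_scheme \<Rightarrow> 'a set \<Rightarrow> 'a set \<Rightarrow> 'a set" where
  "commutator_subgroup G H K =
     generate G {inv\<^bsub>G\<^esub> h \<otimes>\<^bsub>G\<^esub> inv\<^bsub>G\<^esub> k \<otimes>\<^bsub>G\<^esub> h \<otimes>\<^bsub>G\<^esub> k | h k. h \<in> H \<and> k \<in> K}"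

(* The groups of a prefiltration are subgroups of an ambient group G. The first of them,
   Gf 0, may be smaller than G, as happens after a shift. *)
definition prefiltration :: "('a, 'b) monoid_scheme \<Rightarrow> (nat \<Rightarrow> 'a set) \<Rightarrow> bool" where
  "prefiltration G Gf \<longleftrightarrow>
     (\<forall>i. subgroup (Gf i) G) \<and>
     (\<forall>i. Gf (Suc i) \<subseteq> Gf i) \<and>
     (\<forall>i j. commutator_subgroup G (Gf i) (Gf j) \<subseteq> Gf (i + j))"

(* The first disjunct is length minus infinity. *)
definition has_finite_length :: "('a, 'b) monoid_scheme \<Rightarrow> (nat \<Rightarrow> 'a set) \<Rightarrow> bool" where
  "has_finite_length G Gf \<longleftrightarrow>
     Gf 0 = {\<one>\<^bsub>G\<^esub>} \<or> (\<exists>d::nat. Gf (d + 1) = {\<one>\<^bsub>G\<^esub>})"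

definition shift :: "(nat \<Rightarrow> 'a set) \<Rightarrow> nat \<Rightarrow> 'a set" where
  "shift Gf i = Gf (i + 1)"

(* The recursion on the length, written as an inductive predicate: each derivative lowers the
   length by one, and the first rule is the case of length minus infinity. The length itself
   is not an argument because it is not unique (a group trivial at d + 1 is trivial at d + 2);
   the outcome does not depend on the choice, since for trivial Gf 0 the second rule also
   yields only the constant identity. *)
inductive polynomial_map ::
  "('a, 'b) monoid_scheme \<Rightarrow> (nat \<Rightarrow> 'a set) \<Rightarrow> (nat fset \<Rightarrow> 'a) \<Rightarrow> bool"
  for G (structure) where
  trivial: "Gf 0 = {\<one>} \<Longrightarrow> (\<forall>\<alpha>. g \<alpha> = \<one>) \<Longrightarrow> polynomial_map G Gf g"
| derivative: "(\<forall>\<alpha>. g \<alpha> \<in> Gf 0) \<Longrightarrow>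
    (\<forall>\<alpha>. \<exists>Dg. polynomial_map G (shift Gf) Dg \<and>
       (\<forall>\<beta>. \<alpha> |\<inter>| \<beta> = {||} \<longrightarrow> Dg \<beta> = inv (g \<beta>) \<otimes> g (\<alpha> |\<union>| \<beta>))) \<Longrightarrow>
    polynomial_map G Gf g"

definition VIP :: "('a, 'b) monoid_scheme \<Rightarrow> (nat \<Rightarrow> 'a set) \<Rightarrow> (nat fset \<Rightarrow> 'a) set" where
  "VIP G Gf = {g. polynomial_map G Gf g \<and> g {||} = \<one>\<^bsub>G\<^esub>}"

definition right_action_by_homeomorphisms ::
  "('a, 'b) monoid_scheme \<Rightarrow> 'x::topological_space set \<Rightarrow> ('x \<Rightarrow> 'a \<Rightarrow> 'x) \<Rightarrow> bool" where
  "right_action_by_homeomorphisms G X act \<longleftrightarrow>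
     (\<forall>x\<in>X. act x \<one>\<^bsub>G\<^esub> = x) \<and>
     (\<forall>x\<in>X. \<forall>g\<in>carrier G. \<forall>h\<in>carrier G. act (act x g) h = act x (g \<otimes>\<^bsub>G\<^esub> h)) \<and>
     (\<forall>g\<in>carrier G. \<exists>f. homeomorphism X X (\<lambda>x. act x g) f)"

end

theory Submission
  imports Defs "HOL-Algebra.Product_Groups"
begin

text \<open>The proof is a colour focusing argument, as for van der Waerden's theorem, run along PET induction.

Call a system recurrent if the conclusion of the theorem holds for it for all \<open>\<epsilon>\<close> and \<open>H\<close>. Given a
system \<open>A\<close> of VIP maps and \<open>h \<in> A\<close>, one builds, uniformly in \<open>x\<close>, translates
\<open>y\<^sub>0, \<dots>, y\<^sub>k\<close> of \<open>x\<close> and successive finite sets \<open>\<alpha>\<^sub>1, \<dots>, \<alpha>\<^sub>k\<close> such that, for \<open>i < i'\<close>, all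
\<open>g (\<alpha>\<^sub>i\<^sub>+\<^sub>1 |\<union>| \<dots> |\<union>| \<alpha>\<^sub>i')\<close> with \<open>g \<in> A\<close> move \<open>y\<^sub>i'\<close> close to \<open>y\<^sub>i\<close> (\<open>chain_of_returns\<close>). If \<open>k\<close> is large, two of
these points are close to each other by compactness, and the later one is then nearly fixed by all \<open>g\<close>
at once (\<open>recurrent_if_derived_recurrent\<close>). Adding a point to the chain
requires that the maps \<open>\<alpha> \<mapsto> t h(\<alpha>)\<^sup>-\<^sup>1 g(\<beta> \<union> \<alpha>) g(\<beta>)\<^sup>-\<^sup>1 t\<^sup>-\<^sup>1\<close> form a recurrent system, where \<open>\<beta>\<close>
and \<open>t\<close> range over the finitely many sets and translations that the chain has used so far.

This derived system is simpler than \<open>A\<close> when \<open>h\<close> has maximal level, the level of a nontrivial VIP map being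
the largest \<open>l\<close> such that it is VIP for the \<open>l\<close>-fold shift. Modulo maps of higher level than \<open>g\<close>, its
members are \<open>h\<^sup>-\<^sup>1 g\<close>: this moves the class of \<open>h\<close> to higher levels, translates the other classes
of its level and changes nothing at lower levels, so the vector that counts classes per level decreases
lexicographically (\<open>system_order_descent\<close>). For the conjugation by \<open>t\<close> to be harmless it must
gain a level, which is why all translations are taken from the first group of the filtration, where
VIP maps have their values.

The algebra behind this is that the maps of each level form a group, with commutators adding
levels (\<open>prefiltration_VIP\<close>). It is obtained from the corresponding statement for maps
with finitely many derivatives under control (\<open>prefiltration_poly_upto\<close>), by induction on their number.\<close>

section \<open>Commutator identities and prefiltrations\<close>

definition commutator :: "('a, 'b) monoid_scheme \<Rightarrow> 'a \<Rightarrow> 'a \<Rightarrow> 'a" where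
  "commutator G x y = inv\<^bsub>G\<^esub> x \<otimes>\<^bsub>G\<^esub> inv\<^bsub>G\<^esub> y \<otimes>\<^bsub>G\<^esub> x \<otimes>\<^bsub>G\<^esub> y"

context group
begin

lemma cancel_inv_left: "x \<in> carrier G \<Longrightarrow> y \<in> carrier G \<Longrightarrow> inv x \<otimes> (x \<otimes> y) = y"
  by (simp flip: m_assoc)

lemma cancel_inv_right: "x \<in> carrier G \<Longrightarrow> y \<in> carrier G \<Longrightarrow> x \<otimes> (inv x \<otimes> y) = y"
  by (simp flip: m_assoc)

text \<open>Together with the default rules for inverses and the unit these equations rewrite every word in group elements
to its reduced form, so the simplifier proves exactly the identities of free groups.\<close>

lemmas word_simps = m_assoc inv_mult_group cancel_inv_left cancel_inv_right

lemma commutator_closed: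
  "x \<in> carrier G \<Longrightarrow> y \<in> carrier G \<Longrightarrow> commutator G x y \<in> carrier G"
  by (simp add: commutator_def)

text \<open>This lemma and the next two write the derivative of a commutator, a product and an inverse in terms
of the derivatives \<open>a\<close> and \<open>b\<close> of the factors. If \<open>x\<close> and \<open>y\<close> have degrees \<open>i\<close> and \<open>j\<close> and the derivatives have
degrees \<open>i + 1\<close> and \<open>j + 1\<close>, then each of the five factors below has degree at least \<open>i + j + 1\<close>.
The right-hand side also contains the undifferentiated commutator \<open>c\<close>, so the identity gives
information about \<open>c\<close> only once \<open>c\<close> itself is controlled to one order of differentiation less.
It follows from expanding \<open>[x a, y b]\<close> with \<open>[x y, z] = [x, z]\<^sup>y [y, z]\<close> and
\<open>[x, y z] = [x, z] [x, y]\<^sup>z\<close> and from writing each conjugate \<open>v\<^sup>w\<close> as \<open>v [v, w]\<close>.\<close>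

lemma commutator_increment:
  assumes "x \<in> carrier G" "a \<in> carrier G" "y \<in> carrier G" "b \<in> carrier G"
  defines "c \<equiv> commutator G x y" and "u \<equiv> commutator G x b"
  shows "inv c \<otimes> commutator G (x \<otimes> a) (y \<otimes> b) =
    u \<otimes> commutator G u c \<otimes> commutator G c b \<otimes>
    commutator G (u \<otimes> c \<otimes> commutator G c b) a \<otimes> commutator G a (y \<otimes> b)"
  using assms(1-4) unfolding c_def u_def commutator_def by (simp add: word_simps)

lemma product_increment:
  assumes "x \<in> carrier G" "a \<in> carrier G" "y \<in> carrier G" "b \<in> carrier G"
  shows "inv (x \<otimes> y) \<otimes> ((x \<otimes> a) \<otimes> (y \<otimes> b)) = a \<otimes> commutator G a y \<otimes> b"
  using assms unfolding commutator_def by (simp add: word_simps)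

lemma inverse_increment:
  assumes "x \<in> carrier G" "a \<in> carrier G"
  shows "inv (inv x) \<otimes> inv (x \<otimes> a) = inv a \<otimes> commutator G (inv a) (inv x)"
  using assms unfolding commutator_def by (simp add: word_simps)

lemma l_coset_eq_iff:
  assumes "subgroup K G" "x \<in> carrier G" "y \<in> carrier G"
  shows "l_coset G x K = l_coset G y K \<longleftrightarrow> inv x \<otimes> y \<in> K"
proof -
  have "l_coset G x K = l_coset G y K \<longleftrightarrow> (rcong K) `` {x} = (rcong K) `` {y}"
    using subgroup.l_coset_eq_rcong[OF assms(1) is_group] assms(2,3) by simp
  also have "\<dots> \<longleftrightarrow> (x, y) \<in> rcong K"
    using eq_equiv_class_iff[OF subgroup.equiv_rcong[OF assms(1) is_group] assms(2,3)] .
  finally show ?thesis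
    using assms(2,3) by (simp add: r_congruent_def)
qed

lemma prefiltrationI:
  assumes "\<And>i. subgroup (V i) G" "\<And>i. V (Suc i) \<subseteq> V i"
    and "\<And>i j x y. x \<in> V i \<Longrightarrow> y \<in> V j \<Longrightarrow> commutator G x y \<in> V (i + j)"
  shows "prefiltration G V"
proof -
  have "commutator_subgroup G (V i) (V j) \<subseteq> V (i + j)" for i j
    unfolding commutator_subgroup_def
    using assms(3) by (intro generate_subgroup_incl assms(1)) (auto simp: commutator_def)
  then show ?thesis
    using assms(1,2) by (simp add: prefiltration_def)
qed

end

lemma prefiltration_subgroup: "prefiltration G V \<Longrightarrow> subgroup (V i) G"
  by (simp add: prefiltration_def)

lemma prefiltration_antimono: "prefiltration G V \<Longrightarrow> i \<le> j \<Longrightarrow> V j \<subseteq> V i"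
  by (rule lift_Suc_antimono_le) (auto simp: prefiltration_def)

lemma prefiltration_commutator:
  "prefiltration G V \<Longrightarrow> x \<in> V i \<Longrightarrow> y \<in> V j \<Longrightarrow> commutator G x y \<in> V (i + j)"
proof -
  assume V: "prefiltration G V" and "x \<in> V i" "y \<in> V j"
  then have "commutator G x y \<in> commutator_subgroup G (V i) (V j)"
    unfolding commutator_subgroup_def commutator_def by (intro generate.incl) auto
  then show ?thesis
    using V unfolding prefiltration_def by blast
qed

section \<open>The group of polynomial maps\<close>

abbreviation map_group :: "('a, 'b) monoid_scheme \<Rightarrow> (nat fset \<Rightarrow> 'a) monoid" where
  "map_group G \<equiv> product_group UNIV (\<lambda>_. G)"

lemma Bex_mono: "A \<subseteq> B \<Longrightarrow> \<exists>x\<in>A. P x \<Longrightarrow> \<exists>x\<in>B. P x"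
  by blast

text \<open>\<open>poly_upto G Gf n t\<close> asks for the polynomial condition of degree \<open>t\<close> on iterated derivatives of
order at most \<open>n\<close> only. Truncating the order of differentiation makes the closure properties
provable by an upward induction on \<open>n\<close>: the derivative of a commutator involves the commutator
itself, which is then already known to be polynomial up to order \<open>n\<close> when its derivatives up to
order \<open>n + 1\<close> are studied.\<close>

primrec poly_upto ::
  "('a, 'b) monoid_scheme \<Rightarrow> (nat \<Rightarrow> 'a set) \<Rightarrow> nat \<Rightarrow> nat \<Rightarrow> (nat fset \<Rightarrow> 'a) set" where
  "poly_upto G Gf 0 t = {g. \<forall>\<alpha>. g \<alpha> \<in> Gf t}"
| "poly_upto G Gf (Suc n) t = {g. (\<forall>\<alpha>. g \<alpha> \<in> Gf t) \<and>
     (\<forall>\<alpha>. \<exists>Dg \<in> poly_upto G Gf n (Suc t).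
        \<forall>\<beta>. \<alpha> |\<inter>| \<beta> = {||} \<longrightarrow> Dg \<beta> = inv\<^bsub>G\<^esub> (g \<beta>) \<otimes>\<^bsub>G\<^esub> g (\<alpha> |\<union>| \<beta>))}"

context
  fixes G :: "('a, 'b) monoid_scheme" (structure) and Gf :: "nat \<Rightarrow> 'a set"
  assumes group: "group G" and filt: "prefiltration G Gf"
begin

interpretation group G by (rule group)
interpretation maps: group "map_group G" using group by simp

lemma filtration_carrier: "x \<in> Gf i \<Longrightarrow> x \<in> carrier G"
  by (rule subgroup.mem_carrier[OF prefiltration_subgroup[OF filt]])

lemma poly_upto_values: "g \<in> poly_upto G Gf n t \<Longrightarrow> g \<alpha> \<in> Gf t"
  by (cases n) auto

lemma poly_upto_carrier: "g \<in> poly_upto G Gf n t \<Longrightarrow> g \<in> carrier (map_group G)"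
  using filtration_carrier[OF poly_upto_values] by (simp add: PiE_def Pi_def)

lemma inv_map_group: "g \<in> carrier (map_group G) \<Longrightarrow> inv\<^bsub>map_group G\<^esub> g = (\<lambda>\<alpha>. inv (g \<alpha>))"
  using group by (subst inv_product_group) auto

lemma mult_map_group: "g \<otimes>\<^bsub>map_group G\<^esub> h = (\<lambda>\<alpha>. g \<alpha> \<otimes> h \<alpha>)"
  by (simp add: fun_eq_iff)

lemma commutator_map_group:
  assumes "g \<in> carrier (map_group G)" "h \<in> carrier (map_group G)"
  shows "commutator (map_group G) g h = (\<lambda>\<alpha>. commutator G (g \<alpha>) (h \<alpha>))"
  using assms by (simp add: commutator_def inv_map_group fun_eq_iff)

lemma poly_upto_SucI:
  assumes "\<And>\<alpha>. g \<alpha> \<in> Gf t"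
    and "\<And>\<alpha>. \<exists>Dg \<in> poly_upto G Gf n (Suc t).
        \<forall>\<beta>. \<alpha> |\<inter>| \<beta> = {||} \<longrightarrow> Dg \<beta> = inv (g \<beta>) \<otimes> g (\<alpha> |\<union>| \<beta>)"
  shows "g \<in> poly_upto G Gf (Suc n) t"
  using assms by simp

lemma poly_upto_SucD:
  assumes "g \<in> poly_upto G Gf (Suc n) t"
  shows "\<exists>Dg \<in> poly_upto G Gf n (Suc t).
        \<forall>\<beta>. \<alpha> |\<inter>| \<beta> = {||} \<longrightarrow> Dg \<beta> = inv (g \<beta>) \<otimes> g (\<alpha> |\<union>| \<beta>)"
  using assms by simp

lemma poly_upto_Suc_subset: "poly_upto G Gf (Suc n) t \<subseteq> poly_upto G Gf n t"
proof (induction n arbitrary: t)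
  case 0
  then show ?case by auto
next
  case (Suc n)
  show ?case
  proof
    fix g assume g: "g \<in> poly_upto G Gf (Suc (Suc n)) t"
    show "g \<in> poly_upto G Gf (Suc n) t"
      by (intro poly_upto_SucI poly_upto_values[OF g] Bex_mono[OF Suc.IH poly_upto_SucD[OF g]])
  qed
qed

lemma poly_upto_shift_subset: "poly_upto G Gf n (Suc t) \<subseteq> poly_upto G Gf n t"
proof (induction n arbitrary: t)
  case 0
  then show ?case using prefiltration_antimono[OF filt, of t "Suc t"] by auto
next
  case (Suc n)
  show ?case
  proof
    fix g assume g: "g \<in> poly_upto G Gf (Suc n) (Suc t)"
    show "g \<in> poly_upto G Gf (Suc n) t"
    proof (rule poly_upto_SucI)
      show "g \<alpha> \<in> Gf t" for \<alpha>
        using poly_upto_values[OF g] prefiltration_antimono[OF filt, of t "Suc t"] by auto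
    qed (rule Bex_mono[OF Suc.IH poly_upto_SucD[OF g]])
  qed
qed

lemma poly_upto_const: "c \<in> Gf t \<Longrightarrow> (\<lambda>_. c) \<in> poly_upto G Gf n t"
proof (induction n arbitrary: t c)
  case (Suc n)
  have "\<one> \<in> Gf (Suc t)"
    by (rule subgroup.one_closed[OF prefiltration_subgroup[OF filt]])
  then have one: "(\<lambda>_. \<one>) \<in> poly_upto G Gf n (Suc t)"
    by (rule Suc.IH)
  have "c \<in> carrier G"
    by (rule filtration_carrier[OF Suc.prems])
  then show ?case
    by (intro poly_upto_SucI bexI[OF _ one] Suc.prems) simp
qed auto

lemma poly_upto_SucE:
  assumes "g \<in> poly_upto G Gf (Suc n) t"
  obtains Dg where "Dg \<in> poly_upto G Gf n (Suc t)"
    and "\<And>\<beta>. \<alpha> |\<inter>| \<beta> = {||} \<Longrightarrow> g (\<alpha> |\<union>| \<beta>) = g \<beta> \<otimes> Dg \<beta>"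
proof -
  obtain Dg where Dg: "Dg \<in> poly_upto G Gf n (Suc t)"
    "\<And>\<beta>. \<alpha> |\<inter>| \<beta> = {||} \<Longrightarrow> Dg \<beta> = inv (g \<beta>) \<otimes> g (\<alpha> |\<union>| \<beta>)"
    using poly_upto_SucD[OF assms] by blast
  have "g \<beta> \<in> carrier G" for \<beta>
    by (rule filtration_carrier[OF poly_upto_values[OF assms]])
  then show thesis
    using Dg(2) by (intro that[OF Dg(1)]) (simp add: cancel_inv_right)
qed

text \<open>Lazard's theorem for set-polynomials: polynomial maps form a group under pointwise
multiplication, filtered by degree. The increment identities express the first derivative of a
product, inverse or commutator by maps to which the induction hypothesis applies, since a map that
is polynomial up to order \<open>n + 1\<close> is so up to order \<open>n\<close>, and its derivative gains one degree.\<close>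

lemma prefiltration_poly_upto: "prefiltration (map_group G) (poly_upto G Gf n)"
proof (induction n)
  case 0
  show ?case
  proof (rule maps.prefiltrationI)
    fix t
    have "subgroup (Gf t) G" by (rule prefiltration_subgroup[OF filt])
    then have "subgroup (\<Pi>\<^sub>E \<alpha>\<in>UNIV. Gf t) (map_group G)"
      by (subst PiE_subgroup_product_group) (auto simp: group)
    moreover have "(\<Pi>\<^sub>E \<alpha>\<in>UNIV. Gf t) = poly_upto G Gf 0 t"
      by (auto simp: PiE_def)
    ultimately show "subgroup (poly_upto G Gf 0 t) (map_group G)" by simp
  next
    fix t show "poly_upto G Gf 0 (Suc t) \<subseteq> poly_upto G Gf 0 t"
      by (rule poly_upto_shift_subset)
  next
    fix i j g h assume g: "g \<in> poly_upto G Gf 0 i" and h: "h \<in> poly_upto G Gf 0 j"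
    show "commutator (map_group G) g h \<in> poly_upto G Gf 0 (i + j)"
      using prefiltration_commutator[OF filt poly_upto_values[OF g] poly_upto_values[OF h]]
        commutator_map_group[OF poly_upto_carrier[OF g] poly_upto_carrier[OF h]] by simp
  qed
next
  case (Suc n)
  let ?P = "poly_upto G Gf n"
  note sub = prefiltration_subgroup[OF Suc.IH]
  have mult: "(\<lambda>\<alpha>. g \<alpha> \<otimes> h \<alpha>) \<in> ?P t" if "g \<in> ?P t" "h \<in> ?P t" for g h t
    using subgroup.m_closed[OF sub that] unfolding mult_map_group .
  have inver: "(\<lambda>\<alpha>. inv (g \<alpha>)) \<in> ?P t" if "g \<in> ?P t" for g t
    using subgroup.m_inv_closed[OF sub that] unfolding inv_map_group[OF poly_upto_carrier[OF that]] .
  have comm: "(\<lambda>\<alpha>. commutator G (g \<alpha>) (h \<alpha>)) \<in> ?P k"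
    if "g \<in> ?P i" "h \<in> ?P j" "k \<le> i + j" for g h i j k
    using subsetD[OF prefiltration_antimono[OF Suc.IH that(3)]
        prefiltration_commutator[OF Suc.IH that(1,2)]]
    unfolding commutator_map_group[OF poly_upto_carrier[OF that(1)] poly_upto_carrier[OF that(2)]] .
  have low: "g \<in> ?P t" if "g \<in> ?P (Suc t)" for g t
    by (rule subsetD[OF poly_upto_shift_subset that])
  have down: "g \<in> ?P t" if "g \<in> poly_upto G Gf (Suc n) t" for g t
    by (rule subsetD[OF poly_upto_Suc_subset that])
  have car: "g \<alpha> \<in> carrier G" if "g \<in> ?P t" for g t \<alpha>
    by (rule filtration_carrier[OF poly_upto_values[OF that]])
  show ?case
  proof (rule maps.prefiltrationI)
    fix t show "poly_upto G Gf (Suc n) (Suc t) \<subseteq> poly_upto G Gf (Suc n) t"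
      by (rule poly_upto_shift_subset)
  next
    fix t show "subgroup (poly_upto G Gf (Suc n) t) (map_group G)"
    proof (rule maps.subgroupI)
      show "poly_upto G Gf (Suc n) t \<subseteq> carrier (map_group G)"
        using poly_upto_carrier by blast
      have "(\<lambda>_. \<one>) \<in> poly_upto G Gf (Suc n) t"
        by (rule poly_upto_const) (rule subgroup.one_closed[OF prefiltration_subgroup[OF filt]])
      then show "poly_upto G Gf (Suc n) t \<noteq> {}" by blast
    next
      fix g assume g: "g \<in> poly_upto G Gf (Suc n) t"
      have "(\<lambda>\<alpha>. inv (g \<alpha>)) \<in> poly_upto G Gf (Suc n) t"
      proof (rule poly_upto_SucI[OF poly_upto_values[OF inver[OF down[OF g]]]])
        fix \<alpha>
        obtain a where a: "a \<in> ?P (Suc t)"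
          "\<And>\<beta>. \<alpha> |\<inter>| \<beta> = {||} \<Longrightarrow> g (\<alpha> |\<union>| \<beta>) = g \<beta> \<otimes> a \<beta>"
          using poly_upto_SucE[OF g, of \<alpha>] by blast
        show "\<exists>D\<in>?P (Suc t). \<forall>\<beta>. \<alpha> |\<inter>| \<beta> = {||} \<longrightarrow> D \<beta> = inv (inv (g \<beta>)) \<otimes> inv (g (\<alpha> |\<union>| \<beta>))"
        proof (intro bexI allI impI)
          show "(\<lambda>\<beta>. inv (a \<beta>) \<otimes> commutator G (inv (a \<beta>)) (inv (g \<beta>))) \<in> ?P (Suc t)"
            by (intro mult inver comm[where i = "Suc t" and j = t] a down[OF g]) simp
          show "inv (a \<beta>) \<otimes> commutator G (inv (a \<beta>)) (inv (g \<beta>)) =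
              inv (inv (g \<beta>)) \<otimes> inv (g (\<alpha> |\<union>| \<beta>))" if "\<alpha> |\<inter>| \<beta> = {||}" for \<beta>
            unfolding a(2)[OF that]
            by (rule inverse_increment[OF car[OF down[OF g]] car[OF a(1)], symmetric])
        qed
      qed
      then show "inv\<^bsub>map_group G\<^esub> g \<in> poly_upto G Gf (Suc n) t"
        unfolding inv_map_group[OF poly_upto_carrier[OF g]] .
    next
      fix g h assume g: "g \<in> poly_upto G Gf (Suc n) t" and h: "h \<in> poly_upto G Gf (Suc n) t"
      have "(\<lambda>\<alpha>. g \<alpha> \<otimes> h \<alpha>) \<in> poly_upto G Gf (Suc n) t"
      proof (rule poly_upto_SucI[OF poly_upto_values[OF mult[OF down[OF g] down[OF h]]]])
        fix \<alpha>
        obtain a where a: "a \<in> ?P (Suc t)"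
          "\<And>\<beta>. \<alpha> |\<inter>| \<beta> = {||} \<Longrightarrow> g (\<alpha> |\<union>| \<beta>) = g \<beta> \<otimes> a \<beta>"
          using poly_upto_SucE[OF g, of \<alpha>] by blast
        obtain b where b: "b \<in> ?P (Suc t)"
          "\<And>\<beta>. \<alpha> |\<inter>| \<beta> = {||} \<Longrightarrow> h (\<alpha> |\<union>| \<beta>) = h \<beta> \<otimes> b \<beta>"
          using poly_upto_SucE[OF h, of \<alpha>] by blast
        show "\<exists>D\<in>?P (Suc t). \<forall>\<beta>. \<alpha> |\<inter>| \<beta> = {||} \<longrightarrow>
            D \<beta> = inv (g \<beta> \<otimes> h \<beta>) \<otimes> (g (\<alpha> |\<union>| \<beta>) \<otimes> h (\<alpha> |\<union>| \<beta>))"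
        proof (intro bexI allI impI)
          show "(\<lambda>\<beta>. a \<beta> \<otimes> commutator G (a \<beta>) (h \<beta>) \<otimes> b \<beta>) \<in> ?P (Suc t)"
            by (intro mult comm[where i = "Suc t" and j = t] a b down[OF h]) simp
          show "a \<beta> \<otimes> commutator G (a \<beta>) (h \<beta>) \<otimes> b \<beta> =
              inv (g \<beta> \<otimes> h \<beta>) \<otimes> (g (\<alpha> |\<union>| \<beta>) \<otimes> h (\<alpha> |\<union>| \<beta>))" if "\<alpha> |\<inter>| \<beta> = {||}" for \<beta>
            unfolding a(2)[OF that] b(2)[OF that]
            by (rule product_increment[OF car[OF down[OF g]] car[OF a(1)]
                  car[OF down[OF h]] car[OF b(1)], symmetric])
        qed
      qed
      then show "g \<otimes>\<^bsub>map_group G\<^esub> h \<in> poly_upto G Gf (Suc n) t"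
        unfolding mult_map_group .
    qed
  next
    fix i j g h assume g: "g \<in> poly_upto G Gf (Suc n) i" and h: "h \<in> poly_upto G Gf (Suc n) j"
    let ?c = "\<lambda>\<alpha>. commutator G (g \<alpha>) (h \<alpha>)"
    have c: "?c \<in> ?P (i + j)"
      by (rule comm[OF down[OF g] down[OF h]]) simp
    have "?c \<in> poly_upto G Gf (Suc n) (i + j)"
    proof (rule poly_upto_SucI[OF poly_upto_values[OF c]])
      fix \<alpha>
      obtain a where a: "a \<in> ?P (Suc i)"
        "\<And>\<beta>. \<alpha> |\<inter>| \<beta> = {||} \<Longrightarrow> g (\<alpha> |\<union>| \<beta>) = g \<beta> \<otimes> a \<beta>"
        using poly_upto_SucE[OF g, of \<alpha>] by blast
      obtain b where b: "b \<in> ?P (Suc j)"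
        "\<And>\<beta>. \<alpha> |\<inter>| \<beta> = {||} \<Longrightarrow> h (\<alpha> |\<union>| \<beta>) = h \<beta> \<otimes> b \<beta>"
        using poly_upto_SucE[OF h, of \<alpha>] by blast
      \<comment> \<open>\<open>u\<close>, \<open>v\<close>, \<open>w\<close> are the pieces \<open>[g, b]\<close>, \<open>[c, b]\<close> and \<open>u c v\<close> of the increment identity.\<close>
      let ?u = "\<lambda>\<beta>. commutator G (g \<beta>) (b \<beta>)"
      let ?v = "\<lambda>\<beta>. commutator G (?c \<beta>) (b \<beta>)"
      have u: "?u \<in> ?P (Suc (i + j))"
        by (rule comm[OF down[OF g] b(1)]) simp
      have v: "?v \<in> ?P (Suc (i + j))"
        by (rule comm[OF c b(1)]) simp
      have w: "(\<lambda>\<beta>. ?u \<beta> \<otimes> ?c \<beta> \<otimes> ?v \<beta>) \<in> ?P (i + j)"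
        by (rule mult[OF mult[OF low[OF u] c] low[OF v]])
      show "\<exists>D\<in>?P (Suc (i + j)). \<forall>\<beta>. \<alpha> |\<inter>| \<beta> = {||} \<longrightarrow> D \<beta> = inv (?c \<beta>) \<otimes> ?c (\<alpha> |\<union>| \<beta>)"
      proof (intro bexI allI impI)
        show "(\<lambda>\<beta>. ?u \<beta> \<otimes> commutator G (?u \<beta>) (?c \<beta>) \<otimes> ?v \<beta> \<otimes>
            commutator G (?u \<beta> \<otimes> ?c \<beta> \<otimes> ?v \<beta>) (a \<beta>) \<otimes> commutator G (a \<beta>) (h \<beta> \<otimes> b \<beta>))
            \<in> ?P (Suc (i + j))"
          by (rule mult[OF mult[OF mult[OF mult[OF u comm[OF u c]] v] comm[OF w a(1)]]
                comm[OF a(1) mult[OF down[OF h] low[OF b(1)]]]]) simp_all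
        show "?u \<beta> \<otimes> commutator G (?u \<beta>) (?c \<beta>) \<otimes> ?v \<beta> \<otimes>
            commutator G (?u \<beta> \<otimes> ?c \<beta> \<otimes> ?v \<beta>) (a \<beta>) \<otimes> commutator G (a \<beta>) (h \<beta> \<otimes> b \<beta>) =
            inv (?c \<beta>) \<otimes> ?c (\<alpha> |\<union>| \<beta>)" if "\<alpha> |\<inter>| \<beta> = {||}" for \<beta>
          unfolding a(2)[OF that] b(2)[OF that]
          by (rule commutator_increment[OF car[OF down[OF g]] car[OF a(1)]
                car[OF down[OF h]] car[OF b(1)], symmetric])
      qed
    qed
    then show "commutator (map_group G) g h \<in> poly_upto G Gf (Suc n) (i + j)"
      unfolding commutator_map_group[OF poly_upto_carrier[OF g] poly_upto_carrier[OF h]] .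
  qed
qed

lemma filtration_trivial:
  assumes "Gf D = {\<one>}" "D \<le> i"
  shows "Gf i = {\<one>}"
proof
  show "Gf i \<subseteq> {\<one>}"
    using prefiltration_antimono[OF filt assms(2)] unfolding assms(1) .
  show "{\<one>} \<subseteq> Gf i"
    using subgroup.one_closed[OF prefiltration_subgroup[OF filt]] by simp
qed

lemma poly_upto_if_polynomial_map:
  assumes "polynomial_map G F g" "F = (\<lambda>i. Gf (i + t))"
  shows "g \<in> poly_upto G Gf n t"
  using assms
proof (induction arbitrary: t n rule: polynomial_map.induct)
  case (trivial F g)
  have "g = (\<lambda>_. \<one>)" using trivial.hyps(2) by (simp add: fun_eq_iff)
  show ?case
    unfolding \<open>g = _\<close> by (rule poly_upto_const[OF subgroup.one_closed[OF prefiltration_subgroup[OF filt]]])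
next
  case (derivative g F)
  have val: "g \<alpha> \<in> Gf t" for \<alpha>
    using derivative.hyps(1) derivative.prems by simp
  show ?case
  proof (cases n)
    case 0
    then show ?thesis using val by simp
  next
    case (Suc m)
    have sh: "shift F = (\<lambda>i. Gf (i + Suc t))"
      using derivative.prems by (simp add: shift_def fun_eq_iff)
    have "g \<in> poly_upto G Gf (Suc m) t"
    proof (rule poly_upto_SucI[OF val])
      fix \<alpha>
      obtain Dg where IH: "\<forall>t. shift F = (\<lambda>i. Gf (i + t)) \<longrightarrow> (\<forall>n. Dg \<in> poly_upto G Gf n t)"
        and Dg: "\<forall>\<beta>. \<alpha> |\<inter>| \<beta> = {||} \<longrightarrow> Dg \<beta> = inv (g \<beta>) \<otimes> g (\<alpha> |\<union>| \<beta>)"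
        using spec[OF derivative.IH, of \<alpha>] by (elim exE conjE) (rule that)
      have "Dg \<in> poly_upto G Gf m (Suc t)"
        using IH sh by blast
      then show "\<exists>Dg \<in> poly_upto G Gf m (Suc t).
          \<forall>\<beta>. \<alpha> |\<inter>| \<beta> = {||} \<longrightarrow> Dg \<beta> = inv (g \<beta>) \<otimes> g (\<alpha> |\<union>| \<beta>)"
        using Dg by blast
    qed
    then show ?thesis using Suc by simp
  qed
qed

text \<open>Once order plus degree reaches the length, truncation loses nothing: the derivatives of order \<open>n\<close>
take values in a trivial group.\<close>

lemma polynomial_map_if_poly_upto:
  assumes "Gf D = {\<one>}" "D \<le> n + t" "g \<in> poly_upto G Gf n t"
  shows "polynomial_map G (\<lambda>i. Gf (i + t)) g"
  using assms(2,3)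
proof (induction n arbitrary: t g)
  case 0
  have "Gf t = {\<one>}"
    using filtration_trivial[OF assms(1)] 0 by simp
  then show ?case
    using poly_upto_values[OF 0(2)] by (intro polynomial_map.trivial) auto
next
  case (Suc n)
  show ?case
  proof (rule polynomial_map.derivative)
    show "\<forall>\<alpha>. g \<alpha> \<in> Gf (0 + t)"
      using poly_upto_values[OF Suc.prems(2)] by simp
    have sh: "shift (\<lambda>i. Gf (i + t)) = (\<lambda>i. Gf (i + Suc t))"
      by (simp add: shift_def fun_eq_iff)
    have "polynomial_map G (shift (\<lambda>i. Gf (i + t))) Dg" if "Dg \<in> poly_upto G Gf n (Suc t)" for Dg
      unfolding sh using Suc.prems(1) that by (intro Suc.IH) simp_all
    then show "\<forall>\<alpha>. \<exists>Dg. polynomial_map G (shift (\<lambda>i. Gf (i + t))) Dg \<and>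
        (\<forall>\<beta>. \<alpha> |\<inter>| \<beta> = {||} \<longrightarrow> Dg \<beta> = inv (g \<beta>) \<otimes> g (\<alpha> |\<union>| \<beta>))"
      using poly_upto_SucD[OF Suc.prems(2)] by blast
  qed
qed

lemma VIP_eq_poly_upto:
  assumes "Gf D = {\<one>}" "D \<le> n + t"
  shows "VIP G (\<lambda>i. Gf (i + t)) = {g \<in> poly_upto G Gf n t. g {||} = \<one>}"
  using poly_upto_if_polynomial_map[OF _ refl, of t _ n] polynomial_map_if_poly_upto[OF assms]
  unfolding VIP_def by auto

text \<open>The maps of level at least \<open>t\<close>, that is the VIP maps for the \<open>t\<close>-fold shift, inherit the
filtration, because being trivial at the empty set is preserved by products, inverses and commutators.\<close>

lemma prefiltration_VIP:
  assumes "Gf D = {\<one>}"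
  shows "prefiltration (map_group G) (\<lambda>t. VIP G (\<lambda>i. Gf (i + t)))"
proof -
  let ?K = "{g \<in> carrier (map_group G). g {||} = \<one>}"
  have eq: "VIP G (\<lambda>i. Gf (i + t)) = poly_upto G Gf D t \<inter> ?K" for t
    using VIP_eq_poly_upto[OF assms, of D t] poly_upto_carrier[of _ D t] by auto
  have K: "subgroup ?K (map_group G)"
  proof (rule maps.subgroupI)
    have "(\<lambda>_. \<one>) \<in> ?K" by (simp add: PiE_def Pi_def)
    then show "?K \<noteq> {}" by blast
    show "inv\<^bsub>map_group G\<^esub> g \<in> ?K" if "g \<in> ?K" for g
    proof -
      from that have g: "g \<in> carrier (map_group G)" "g {||} = \<one>" by blast+
      have "(inv\<^bsub>map_group G\<^esub> g) {||} = \<one>"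
        unfolding inv_map_group[OF g(1)] using g(2) by simp
      with maps.inv_closed[OF g(1)] show ?thesis by blast
    qed
    show "g \<otimes>\<^bsub>map_group G\<^esub> h \<in> ?K" if "g \<in> ?K" "h \<in> ?K" for g h
    proof -
      from that have g: "g \<in> carrier (map_group G)" "g {||} = \<one>"
        and h: "h \<in> carrier (map_group G)" "h {||} = \<one>" by blast+
      have "(g \<otimes>\<^bsub>map_group G\<^esub> h) {||} = \<one>"
        unfolding mult_map_group using g(2) h(2) by simp
      with maps.m_closed[OF g(1) h(1)] show ?thesis by blast
    qed
  qed blast
  show ?thesis
    unfolding eq
  proof (rule maps.prefiltrationI)
    show "subgroup (poly_upto G Gf D i \<inter> ?K) (map_group G)" for i
      by (rule maps.subgroups_Inter_pair[OF prefiltration_subgroup[OF prefiltration_poly_upto] K])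
    show "poly_upto G Gf D (Suc i) \<inter> ?K \<subseteq> poly_upto G Gf D i \<inter> ?K" for i
      using poly_upto_shift_subset by blast
    show "commutator (map_group G) g h \<in> poly_upto G Gf D (i + j) \<inter> ?K"
      if "g \<in> poly_upto G Gf D i \<inter> ?K" "h \<in> poly_upto G Gf D j \<inter> ?K" for i j g h
    proof -
      have g: "g \<in> poly_upto G Gf D i" "g \<in> carrier (map_group G)" "g {||} = \<one>"
        and h: "h \<in> poly_upto G Gf D j" "h \<in> carrier (map_group G)" "h {||} = \<one>"
        using that by blast+
      have "commutator (map_group G) g h {||} = \<one>"
        unfolding commutator_map_group[OF g(2) h(2)] using g(3) h(3) by (simp add: commutator_def)
      moreover have "commutator (map_group G) g h \<in> carrier (map_group G)"
        by (rule maps.commutator_closed[OF g(2) h(2)])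
      moreover have "commutator (map_group G) g h \<in> poly_upto G Gf D (i + j)"
        by (rule prefiltration_commutator[OF prefiltration_poly_upto g(1) h(1)])
      ultimately show ?thesis by blast
    qed
  qed
qed

end

section \<open>The well-founded order on systems\<close>

text \<open>PET induction: the members of a system that have exact level \<open>l\<close> are counted modulo the maps of
higher level. Low levels are the most complex ones, so the weight vectors are compared
lexicographically from level zero on; levels from \<open>D\<close> on contain only the identity.\<close>

definition level_weight :: "('g, 'm) monoid_scheme \<Rightarrow> (nat \<Rightarrow> 'g set) \<Rightarrow> 'g set \<Rightarrow> nat \<Rightarrow> nat" where
  "level_weight G V A l = card ((\<lambda>g. l_coset G g (V (Suc l))) ` (A \<inter> (V l - V (Suc l))))"

definition system_order :: "('g, 'm) monoid_scheme \<Rightarrow> (nat \<Rightarrow> 'g set) \<Rightarrow> nat \<Rightarrow> 'g set rel" where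
  "system_order G V D = inv_image (lex less_than) (\<lambda>A. map (level_weight G V A) [0..<D])"

lemma wf_system_order: "wf (system_order G V D)"
  unfolding system_order_def by (intro wf_inv_image wf_lex wf_less_than)

lemma map_upt_lex_less:
  fixes f g :: "nat \<Rightarrow> nat"
  assumes "\<And>l. l < L \<Longrightarrow> f l \<le> g l" "f L < g L" "L < D"
  shows "(map f [0..<D], map g [0..<D]) \<in> lex less_than"
proof -
  define k where "k = (LEAST k. f k < g k)"
  have k: "f k < g k" unfolding k_def by (rule LeastI[of _ L]) (rule assms(2))
  have "k \<le> L" unfolding k_def by (rule Least_le) (rule assms(2))
  have eq: "f l = g l" if "l < k" for l
    using assms(1)[of l] that \<open>k \<le> L\<close> not_less_Least[of l "\<lambda>k. f k < g k"] unfolding k_def by force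
  have "[0..<D] = [0..<k] @ k # [Suc k..<D]"
    using \<open>k \<le> L\<close> assms(3) upt_add_eq_append[of 0 k "D - k"] by (simp add: upt_conv_Cons)
  moreover have "map f [0..<k] = map g [0..<k]"
    using eq by simp
  ultimately have "map f [0..<D] = map g [0..<k] @ f k # map f [Suc k..<D]"
    "map g [0..<D] = map g [0..<k] @ g k # map g [Suc k..<D]"
    by (simp_all only: map_append list.map)
  then show ?thesis
    using k by (simp only:) (rule lex_append_leftI, simp)
qed

lemma exact_level:
  assumes "g \<in> V 0" "g \<notin> V D"
  shows "\<exists>l<D. g \<in> V l \<and> g \<notin> V (Suc l)"
  using assms(2)
proof (induction D)
  case 0
  then show ?case using assms(1) by simp
next
  case (Suc D)
  then show ?case using less_Suc_eq by blast
qed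

text \<open>Dividing a system by a member \<open>h\<close> of maximal level \<open>L\<close> lowers its weight. Below level \<open>L\<close> the factor
\<open>inv h\<close> is invisible modulo the next level, by normality, so every class of \<open>A'\<close> is a class of
\<open>A\<close>. At level \<open>L\<close> the classes of \<open>A'\<close> are translates by \<open>inv h\<close> of classes of \<open>A\<close> other than that
of \<open>h\<close>, since the class of \<open>h\<close> itself is pushed to a higher level. New classes may appear above \<open>L\<close>,
but the lexicographic comparison is decided at \<open>L\<close>.

The members of \<open>A'\<close> may deviate from \<open>inv h \<otimes> g\<close> by an element of level above that of \<open>g\<close>; this
leaves room for derivatives and for conjugation.\<close>

lemma system_order_descent:
  fixes G (structure)
  assumes "group G" and filt: "prefiltration G V"
    and "finite A" "A \<subseteq> V 0"
    and h: "h \<in> A" "h \<in> V L" "h \<notin> V (Suc L)" and L: "L < D"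
    and top: "\<And>g. g \<in> A \<Longrightarrow> g \<notin> V (Suc L)"
    and deriv: "\<And>g'. g' \<in> A' \<Longrightarrow>
      \<exists>g\<in>A. \<exists>l. g \<in> V l \<and> g \<notin> V (Suc l) \<and> inv (inv h \<otimes> g) \<otimes> g' \<in> V (Suc l)"
  shows "(A', A) \<in> system_order G V D"
proof -
  interpret group G by fact
  note sub = prefiltration_subgroup[OF filt]
  have anti: "x \<in> V i" if "x \<in> V j" "i \<le> j" for x i j
    using prefiltration_antimono[OF filt that(2)] that(1) by (rule subsetD)
  have car: "x \<in> carrier G" if "x \<in> V i" for x i
    by (rule subgroup.mem_carrier[OF sub that])
  note mult = subgroup.m_closed[OF sub] and inver = subgroup.m_inv_closed[OF sub]
  \<comment> \<open>A member of \<open>A'\<close> of exact level at most \<open>L\<close> comes from a member of \<open>A\<close> of the same level.\<close>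
  have key: "\<exists>g \<in> A \<inter> (V l - V (Suc l)). inv h \<otimes> g \<in> V l \<and> inv h \<otimes> g \<notin> V (Suc l) \<and>
      l_coset G g' (V (Suc l)) = l_coset G (inv h \<otimes> g) (V (Suc l))"
    if l: "l \<le> L" and g': "g' \<in> A'" "g' \<in> V l" "g' \<notin> V (Suc l)" for l g'
  proof -
    obtain g m where g: "g \<in> A" "g \<in> V m" "g \<notin> V (Suc m)"
      and q: "inv (inv h \<otimes> g) \<otimes> g' \<in> V (Suc m)"
      using deriv[OF g'(1)] by blast
    define p where "p = inv h \<otimes> g"
    note gc = car[OF g(2)] and hc = car[OF h(2)] and g'c = car[OF g'(2)]
    have pc: "p \<in> carrier G" unfolding p_def using gc hc by simp
    have "m \<le> L"
    proof (rule ccontr)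
      assume "\<not> m \<le> L"
      then show False using anti[OF g(2), of "Suc L"] top[OF g(1)] by simp
    qed
    have p: "p \<in> V m"
      unfolding p_def by (rule mult[OF inver[OF anti[OF h(2) \<open>m \<le> L\<close>]] g(2)])
    have g'_eq: "g' = p \<otimes> (inv p \<otimes> g')" and p_eq: "p = g' \<otimes> inv (inv p \<otimes> g')"
      and g_eq: "g = h \<otimes> p"
      using pc g'c hc gc by (simp_all add: p_def word_simps)
    note q' = q[folded p_def]
    have not_p: "p \<notin> V (Suc m)" if "m \<le> l"
    proof
      assume "p \<in> V (Suc m)"
      show False
      proof (cases "m = l")
        case True
        have "g' \<in> V (Suc m)"
          by (subst g'_eq) (rule mult[OF \<open>p \<in> V (Suc m)\<close> q'])
        then show False using g'(3) True by simp
      next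
        case False
        then have "Suc m \<le> L" using that l by simp
        have "g \<in> V (Suc m)"
          by (subst g_eq) (rule mult[OF anti[OF h(2) \<open>Suc m \<le> L\<close>] \<open>p \<in> V (Suc m)\<close>])
        then show False using g(3) by simp
      qed
    qed
    have "m \<le> l"
    proof (rule ccontr)
      assume "\<not> m \<le> l"
      have "g' \<in> V m"
        by (subst g'_eq) (rule mult[OF p anti[OF q']], simp)
      then show False using anti[of g' m "Suc l"] g'(3) \<open>\<not> m \<le> l\<close> by simp
    qed
    moreover have "l \<le> m"
    proof (rule ccontr)
      assume "\<not> l \<le> m"
      have "p \<in> V (Suc m)"
        by (subst p_eq) (rule mult[OF anti[OF g'(2)] inver[OF q']], use \<open>\<not> l \<le> m\<close> in simp)
      then show False using not_p \<open>m \<le> l\<close> by simp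
    qed
    ultimately have "m = l" by simp
    have "l_coset G p (V (Suc l)) = l_coset G g' (V (Suc l))"
      using l_coset_eq_iff[OF sub pc g'c] q' \<open>m = l\<close> by simp
    then show ?thesis
      using g p not_p \<open>m = l\<close> unfolding p_def by (intro bexI[of _ g]) auto
  qed
  have le: "level_weight G V A' l \<le> level_weight G V A l" if "l < L" for l
    unfolding level_weight_def
  proof (rule card_mono)
    show "(\<lambda>g. l_coset G g (V (Suc l))) ` (A' \<inter> (V l - V (Suc l))) \<subseteq>
        (\<lambda>g. l_coset G g (V (Suc l))) ` (A \<inter> (V l - V (Suc l)))"
    proof (rule image_subsetI)
      fix g' assume g': "g' \<in> A' \<inter> (V l - V (Suc l))"
      obtain g where g: "g \<in> A \<inter> (V l - V (Suc l))"
        and eq: "l_coset G g' (V (Suc l)) = l_coset G (inv h \<otimes> g) (V (Suc l))"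
        using key[of l g'] g' \<open>l < L\<close> by auto
      have hl: "h \<in> V (Suc l)" using anti[OF h(2)] that by simp
      have g0: "g \<in> V 0" and gc: "g \<in> carrier G" and hc: "h \<in> carrier G"
        using g assms(4) car h(2) by auto
      have "inv (inv h \<otimes> g) \<otimes> g = h \<otimes> commutator G h g"
        using gc hc by (simp add: word_simps commutator_def)
      also have "\<dots> \<in> V (Suc l)"
        using mult[OF hl] prefiltration_commutator[OF filt hl g0] by simp
      finally have "l_coset G (inv h \<otimes> g) (V (Suc l)) = l_coset G g (V (Suc l))"
        using l_coset_eq_iff[OF sub] gc hc by simp
      then show "l_coset G g' (V (Suc l)) \<in> (\<lambda>g. l_coset G g (V (Suc l))) ` (A \<inter> (V l - V (Suc l)))"
        using g eq by blast
    qed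
  qed (use assms(3) in simp)
  have less: "level_weight G V A' L < level_weight G V A L"
  proof -
    let ?C = "(\<lambda>g. l_coset G g (V (Suc L))) ` (A \<inter> (V L - V (Suc L)))"
    let ?K = "l_coset G h (V (Suc L))"
    have "finite ?C" using assms(3) by simp
    have "?K \<in> ?C" using h by blast
    have "(\<lambda>g. l_coset G g (V (Suc L))) ` (A' \<inter> (V L - V (Suc L))) \<subseteq> (\<lambda>K. l_coset G (inv h) K) ` (?C - {?K})"
    proof (rule image_subsetI)
      fix g' assume g': "g' \<in> A' \<inter> (V L - V (Suc L))"
      obtain g where g: "g \<in> A \<inter> (V L - V (Suc L))" and p: "inv h \<otimes> g \<notin> V (Suc L)"
        and eq: "l_coset G g' (V (Suc L)) = l_coset G (inv h \<otimes> g) (V (Suc L))"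
        using key[of L g'] g' by auto
      have gc: "g \<in> carrier G" and hc: "h \<in> carrier G"
        using g car h(2) by auto
      have "?K \<noteq> l_coset G g (V (Suc L))"
        using l_coset_eq_iff[OF sub hc gc] p by simp
      moreover have "l_coset G (inv h \<otimes> g) (V (Suc L)) = l_coset G (inv h) (l_coset G g (V (Suc L)))"
        using lcos_m_assoc[OF subgroup.subset[OF sub] _ gc] hc by simp
      ultimately show "l_coset G g' (V (Suc L)) \<in> (\<lambda>K. l_coset G (inv h) K) ` (?C - {?K})"
        using eq g by blast
    qed
    then have "level_weight G V A' L \<le> card (?C - {?K})"
      unfolding level_weight_def
      by (rule surj_card_le[rotated]) (use \<open>finite ?C\<close> in simp)
    also have "\<dots> < card ?C"
      using \<open>finite ?C\<close> \<open>?K \<in> ?C\<close> by (rule card_Diff1_less)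
    finally show ?thesis unfolding level_weight_def .
  qed
  show ?thesis
    unfolding system_order_def in_inv_image by (rule map_upt_lex_less[of L]) (use le less L in simp_all)
qed

section \<open>Recurrence of a system under a compact action\<close>

text \<open>The conclusion of the theorem for one system, with the translating elements restricted to a
subset \<open>K\<close>. Below, \<open>K\<close> is the first group of the filtration rather than the whole
group: the induction conjugates maps by products of translating elements, and conjugation by
an element of \<open>K\<close> changes a map of level \<open>l\<close> only by a factor of level \<open>l + 1\<close>, whereas
conjugation by an arbitrary element could create a new class of level \<open>l\<close>.\<close>

definition recurrent ::
  "('a, 'b) monoid_scheme \<Rightarrow> 'a set \<Rightarrow> 'x::metric_space set \<Rightarrow> ('x \<Rightarrow> 'a \<Rightarrow> 'x) \<Rightarrow>
    (nat fset \<Rightarrow> 'a) set \<Rightarrow> bool" where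
  "recurrent G K X act A \<longleftrightarrow> (\<forall>\<epsilon>>0. \<forall>H. \<exists>N S.
     (\<forall>m n. m |\<in>| H \<longrightarrow> n |\<in>| N \<longrightarrow> m < n) \<and> finite S \<and> S \<subseteq> K \<and>
     (\<forall>x\<in>X. \<exists>\<alpha> s. \<alpha> \<noteq> {||} \<and> \<alpha> |\<subseteq>| N \<and> s \<in> S \<and>
       (\<forall>g\<in>A. dist (act (act x s) (g \<alpha>)) (act x s) < \<epsilon>)))"

lemma recurrentE:
  assumes "recurrent G K X act A" "\<epsilon> > 0"
  obtains N S where "\<And>m n. m |\<in>| H \<Longrightarrow> n |\<in>| N \<Longrightarrow> m < n" "finite S" "S \<subseteq> K"
    "\<And>x. x \<in> X \<Longrightarrow> \<exists>\<alpha> s. \<alpha> \<noteq> {||} \<and> \<alpha> |\<subseteq>| N \<and> s \<in> S \<and>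
       (\<forall>g\<in>A. dist (act (act x s) (g \<alpha>)) (act x s) < \<epsilon>)"
proof -
  obtain N S where NS: "(\<forall>m n. m |\<in>| H \<longrightarrow> n |\<in>| N \<longrightarrow> m < n) \<and> finite S \<and> S \<subseteq> K \<and>
     (\<forall>x\<in>X. \<exists>\<alpha> s. \<alpha> \<noteq> {||} \<and> \<alpha> |\<subseteq>| N \<and> s \<in> S \<and>
       (\<forall>g\<in>A. dist (act (act x s) (g \<alpha>)) (act x s) < \<epsilon>))"
    using assms(1)[unfolded recurrent_def, THEN spec, THEN mp, OF assms(2), THEN spec[of _ H]]
    by (elim exE) (rule that)
  show thesis
    by (rule that[of N S]) (use NS in blast)+
qed

locale compact_action = group G
  for G :: "('a, 'b) monoid_scheme" (structure) +
  fixes X :: "'x::metric_space set" and act :: "'x \<Rightarrow> 'a \<Rightarrow> 'x"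
  assumes compact: "compact X" and action: "right_action_by_homeomorphisms G X act"
begin

lemma act_one: "x \<in> X \<Longrightarrow> act x \<one> = x"
  using action by (simp add: right_action_by_homeomorphisms_def)

lemma act_act: "x \<in> X \<Longrightarrow> g \<in> carrier G \<Longrightarrow> h \<in> carrier G \<Longrightarrow> act (act x g) h = act x (g \<otimes> h)"
  using action by (simp add: right_action_by_homeomorphisms_def)

lemma act_homeomorphism:
  assumes "g \<in> carrier G"
  obtains f where "homeomorphism X X (\<lambda>x. act x g) f"
  using action assms unfolding right_action_by_homeomorphisms_def by blast

lemma act_closed:
  assumes "x \<in> X" "g \<in> carrier G"
  shows "act x g \<in> X"
proof -
  obtain f where "homeomorphism X X (\<lambda>x. act x g) f"
    using act_homeomorphism[OF assms(2)] .
  then have "(\<lambda>x. act x g) ` X = X" by (rule homeomorphism_image1)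
  then show ?thesis using assms(1) by blast
qed

lemma act_uniformly_continuous:
  assumes "g \<in> carrier G" "\<delta> > 0"
  shows "\<exists>\<eta>>0. \<forall>x\<in>X. \<forall>y\<in>X. dist x y < \<eta> \<longrightarrow> dist (act x g) (act y g) < \<delta>"
proof -
  obtain f where "homeomorphism X X (\<lambda>x. act x g) f"
    using act_homeomorphism[OF assms(1)] .
  then have "uniformly_continuous_on X (\<lambda>x. act x g)"
    by (intro compact_uniformly_continuous homeomorphism_cont1 compact)
  then show ?thesis
    using assms(2) unfolding uniformly_continuous_on_def by (metis dist_commute)
qed

lemma finite_equicontinuous:
  assumes "finite K" "K \<subseteq> carrier G" "\<delta> > 0"
  shows "\<exists>\<eta>>0. \<forall>x\<in>X. \<forall>y\<in>X. \<forall>k\<in>K. dist x y < \<eta> \<longrightarrow> dist (act x k) (act y k) < \<delta>"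
  using assms(1,2)
proof (induction K rule: finite_induct)
  case empty
  then show ?case by (intro exI[of _ 1]) simp
next
  case (insert k K)
  obtain \<eta> where \<eta>: "\<eta> > 0" "\<And>x y k. x \<in> X \<Longrightarrow> y \<in> X \<Longrightarrow> k \<in> K \<Longrightarrow> dist x y < \<eta> \<Longrightarrow>
      dist (act x k) (act y k) < \<delta>"
    using insert by auto
  obtain \<eta>' where \<eta>': "\<eta>' > 0" "\<And>x y. x \<in> X \<Longrightarrow> y \<in> X \<Longrightarrow> dist x y < \<eta>' \<Longrightarrow>
      dist (act x k) (act y k) < \<delta>"
    using act_uniformly_continuous[of k \<delta>] insert.prems assms(3) by auto
  show ?case
    using \<eta> \<eta>' by (intro exI[of _ "min \<eta> \<eta>'"]) auto
qed

lemma compact_pigeonhole: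
  fixes \<epsilon> :: real
  assumes "\<epsilon> > 0"
  obtains k :: nat where
    "\<And>y :: nat \<Rightarrow> 'x. (\<And>i. i \<le> k \<Longrightarrow> y i \<in> X) \<Longrightarrow> \<exists>i i'. i < i' \<and> i' \<le> k \<and> dist (y i) (y i') < \<epsilon>"
proof -
  obtain C where C: "C \<subseteq> X" "finite C" "X \<subseteq> (\<Union>c\<in>C. ball c (\<epsilon> / 2))"
  proof (rule compactE_image[OF compact])
    show "X \<subseteq> (\<Union>c\<in>X. ball c (\<epsilon> / 2))"
      using assms by force
  qed auto
  show thesis
  proof (rule that[of "card C"])
    fix y :: "nat \<Rightarrow> 'x" assume y: "\<And>i. i \<le> card C \<Longrightarrow> y i \<in> X"
    then have "\<forall>i\<in>{..card C}. \<exists>c. c \<in> C \<and> y i \<in> ball c (\<epsilon> / 2)"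
      using C(3) by blast
    from bchoice[OF this] obtain c where
      c: "\<And>i. i \<le> card C \<Longrightarrow> c i \<in> C \<and> y i \<in> ball (c i) (\<epsilon> / 2)"
      by blast
    have "\<not> inj_on c {..card C}"
      using card_inj_on_le[of c "{..card C}" C] c C(2) by auto
    then obtain i i' where "i < i'" "i' \<le> card C" "c i = c i'"
      unfolding inj_on_def by (metis atMost_iff linorder_neqE_nat)
    then have "dist (y i) (y i') < \<epsilon>"
      using c[of i] c[of i'] dist_triangle_half_r[of "c i" "y i" \<epsilon> "y i'"] by simp
    then show "\<exists>i i'. i < i' \<and> i' \<le> card C \<and> dist (y i) (y i') < \<epsilon>"
      using \<open>i < i'\<close> \<open>i' \<le> card C\<close> by blast
  qed
qed

text \<open>The colour focusing step. Starting from \<open>x\<close>, one finds translates \<open>y\<^sub>0, \<dots>, y\<^sub>j\<close> of \<open>x\<close>, with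
\<open>y\<^sub>i = act x (t i)\<close>, such that each \<open>y\<^sub>i'\<close> is moved close to each earlier \<open>y\<^sub>i\<close> by all \<open>g \<alpha>\<close> at once, for
one set \<open>\<alpha>\<close> depending on \<open>i\<close> and \<open>i'\<close> only.

To prolong the chain, use recurrence of the derived system at \<open>x\<close> to obtain \<open>s\<close> and \<open>\<alpha>\<close>, take
a chain of length \<open>j\<close> starting from \<open>act x s\<close>, and append
the point \<open>y\<^sub>j\<close> translated by the inverse of \<open>h \<alpha>\<close>. For a set \<open>\<beta>\<close> occurring in the shorter chain,
\<open>t \<otimes> inv (h \<alpha>) \<otimes> g (\<beta> |\<union>| \<alpha>)\<close> equals \<open>g' \<alpha> \<otimes> (t \<otimes> g \<beta>)\<close> for a map \<open>g'\<close> of the derived system, and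
\<open>g' \<alpha>\<close> hardly moves \<open>act x s\<close>; so the new point is moved by \<open>g (\<beta> |\<union>| \<alpha>)\<close> close to where \<open>g \<beta>\<close>
moves \<open>y\<^sub>j\<close>. The return precedes the shorter chain, yet its system is built from the
sets \<open>M\<close> and \<open>T\<close> of that chain; this is possible because \<open>M\<close> and \<open>T\<close> are the same for all
starting points.\<close>

lemma chain_of_returns:
  assumes K: "subgroup K G" and A: "finite A"
    and A_values: "\<And>g \<alpha>. g \<in> A \<Longrightarrow> g \<alpha> \<in> K" and A_empty: "\<And>g. g \<in> A \<Longrightarrow> g {||} = \<one>"
    and h: "h \<in> A"
    and derived: "\<And>T M. finite T \<Longrightarrow> T \<subseteq> K \<Longrightarrow> \<exists>A'. recurrent G K X act A' \<and>
      (\<forall>t\<in>T. \<forall>g\<in>A. \<forall>\<beta>. \<beta> |\<subseteq>| M \<longrightarrow> (\<exists>g'\<in>A'. \<forall>\<alpha>. \<beta> |\<inter>| \<alpha> = {||} \<longrightarrow>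
        g' \<alpha> = t \<otimes> (inv (h \<alpha>) \<otimes> g (\<beta> |\<union>| \<alpha>) \<otimes> inv (g \<beta>)) \<otimes> inv t))"
    and \<delta>: "\<delta> > 0"
  shows "\<exists>M T. (\<forall>m n. m |\<in>| H \<longrightarrow> n |\<in>| M \<longrightarrow> m < n) \<and> finite T \<and> T \<subseteq> K \<and>
    (\<forall>x\<in>X. \<exists>t. (\<forall>i\<le>j. t i \<in> T) \<and> (\<forall>i i'. i \<le> i' \<longrightarrow> i' \<le> j \<longrightarrow>
      (\<exists>\<alpha>. \<alpha> |\<subseteq>| M \<and> (i < i' \<longrightarrow> \<alpha> \<noteq> {||}) \<and>
        (\<forall>g\<in>A. dist (act x (t i' \<otimes> g \<alpha>)) (act x (t i)) \<le> real (i' - i) * \<delta>))))"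
proof (induction j)
  case 0
  show ?case
  proof (intro exI[of _ "{||}"] exI[of _ "{\<one>}"] conjI ballI)
    show "{\<one>} \<subseteq> K" using subgroup.one_closed[OF K] by simp
    fix x assume "x \<in> X"
    show "\<exists>t. (\<forall>i\<le>0. t i \<in> {\<one>}) \<and> (\<forall>i i'. i \<le> i' \<longrightarrow> i' \<le> 0 \<longrightarrow>
      (\<exists>\<alpha>. \<alpha> |\<subseteq>| {||} \<and> (i < i' \<longrightarrow> \<alpha> \<noteq> {||}) \<and>
        (\<forall>g\<in>A. dist (act x (t i' \<otimes> g \<alpha>)) (act x (t i)) \<le> real (i' - i) * \<delta>)))"
      by (intro exI[of _ "\<lambda>_. \<one>"]) (auto simp: A_empty)
  qed auto
next
  case (Suc j)
  then obtain M T where M: "\<forall>m n. m |\<in>| H \<longrightarrow> n |\<in>| M \<longrightarrow> m < n" and T: "finite T" "T \<subseteq> K"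
    and IH: "\<forall>x\<in>X. \<exists>t. (\<forall>i\<le>j. t i \<in> T) \<and> (\<forall>i i'. i \<le> i' \<longrightarrow> i' \<le> j \<longrightarrow>
      (\<exists>\<alpha>. \<alpha> |\<subseteq>| M \<and> (i < i' \<longrightarrow> \<alpha> \<noteq> {||}) \<and>
        (\<forall>g\<in>A. dist (act x (t i' \<otimes> g \<alpha>)) (act x (t i)) \<le> real (i' - i) * \<delta>)))"
    by (elim exE conjE) (rule that)
  have car: "k \<in> carrier G" if "k \<in> K" for k
    by (rule subgroup.mem_carrier[OF K that])
  note mult = subgroup.m_closed[OF K] and inver = subgroup.m_inv_closed[OF K]
  obtain A' where A': "recurrent G K X act A'"
    and A'_deriv: "\<forall>t\<in>T. \<forall>g\<in>A. \<forall>\<beta>. \<beta> |\<subseteq>| M \<longrightarrow> (\<exists>g'\<in>A'. \<forall>\<alpha>. \<beta> |\<inter>| \<alpha> = {||} \<longrightarrow>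
        g' \<alpha> = t \<otimes> (inv (h \<alpha>) \<otimes> g (\<beta> |\<union>| \<alpha>) \<otimes> inv (g \<beta>)) \<otimes> inv t)"
    using derived[OF T, of M] by (elim exE conjE) (rule that)
  \<comment> \<open>All elements that the shorter chain can apply after the return; \<open>\<eta>\<close> is a modulus of
    continuity for all of them.\<close>
  define E where "E = (\<lambda>(t, g, \<beta>). t \<otimes> g \<beta>) ` (T \<times> A \<times> fset (fPow M))"
  have "finite E" unfolding E_def using T(1) A by simp
  have "E \<subseteq> carrier G"
  proof
    fix k assume "k \<in> E"
    then obtain t g \<beta> where "k = t \<otimes> g \<beta>" "t \<in> K" "g \<in> A"
      using T(2) unfolding E_def by auto
    then show "k \<in> carrier G"
      using car[OF mult[OF _ A_values]] by simp
  qed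
  obtain \<eta> where \<eta>: "\<eta> > 0"
    and cont: "\<forall>x\<in>X. \<forall>y\<in>X. \<forall>k\<in>E. dist x y < \<eta> \<longrightarrow> dist (act x k) (act y k) < \<delta>"
    using finite_equicontinuous[OF \<open>finite E\<close> \<open>E \<subseteq> carrier G\<close> \<delta>] by blast
  obtain N S where N: "\<And>m n. m |\<in>| H |\<union>| M \<Longrightarrow> n |\<in>| N \<Longrightarrow> m < n" and S: "finite S" "S \<subseteq> K"
    and ret: "\<And>x. x \<in> X \<Longrightarrow> \<exists>\<alpha> s. \<alpha> \<noteq> {||} \<and> \<alpha> |\<subseteq>| N \<and> s \<in> S \<and>
       (\<forall>g\<in>A'. dist (act (act x s) (g \<alpha>)) (act x s) < \<eta>)"
    using recurrentE[OF A' \<eta>, of "H |\<union>| M"] by blast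
  define T' where "T' = (\<lambda>(s, t). s \<otimes> t) ` (S \<times> T) \<union>
    (\<lambda>(s, t, \<alpha>). s \<otimes> (t \<otimes> inv (h \<alpha>))) ` (S \<times> T \<times> fset (fPow N))"
  have "finite T'" unfolding T'_def using S(1) T(1) by simp
  have "T' \<subseteq> K"
  proof
    have hK: "h \<alpha> \<in> K" for \<alpha> by (rule A_values[OF h])
    fix k assume "k \<in> T'"
    then consider s t where "k = s \<otimes> t" "s \<in> S" "t \<in> T"
      | s t \<alpha> where "k = s \<otimes> (t \<otimes> inv (h \<alpha>))" "s \<in> S" "t \<in> T"
      unfolding T'_def by auto
    then show "k \<in> K"
      using S(2) T(2) hK by cases (auto intro!: mult inver)
  qed
  show ?case
  proof (intro exI[of _ "M |\<union>| N"] exI[of _ T'] conjI ballI \<open>finite T'\<close> \<open>T' \<subseteq> K\<close>)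
    show "\<forall>m n. m |\<in>| H \<longrightarrow> n |\<in>| M |\<union>| N \<longrightarrow> m < n"
      using M N by blast
    fix x assume x: "x \<in> X"
    obtain \<alpha> s where \<alpha>: "\<alpha> \<noteq> {||}" "\<alpha> |\<subseteq>| N" and s: "s \<in> S"
      and near: "\<forall>g\<in>A'. dist (act (act x s) (g \<alpha>)) (act x s) < \<eta>"
      using ret[OF x] by blast
    have sK: "s \<in> K" using s S(2) by blast
    define y where "y = act x s"
    have y: "y \<in> X" unfolding y_def by (rule act_closed[OF x car[OF sK]])
    obtain t where t: "\<forall>i\<le>j. t i \<in> T"
      and chain: "\<forall>i i'. i \<le> i' \<longrightarrow> i' \<le> j \<longrightarrow> (\<exists>\<beta>. \<beta> |\<subseteq>| M \<and> (i < i' \<longrightarrow> \<beta> \<noteq> {||}) \<and>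
        (\<forall>g\<in>A. dist (act y (t i' \<otimes> g \<beta>)) (act y (t i)) \<le> real (i' - i) * \<delta>))"
      using bspec[OF IH y] by (elim exE conjE) (rule that)
    have tK: "t i \<in> K" if "i \<le> j" for i using t that T(2) by blast
    have act_s: "act x (s \<otimes> k) = act y k" if "k \<in> K" for k
      unfolding y_def using act_act[OF x car[OF sK] car[OF that]] by simp
    define r where "r = t j \<otimes> inv (h \<alpha>)"
    have rK: "r \<in> K" unfolding r_def by (rule mult[OF tK[OF order_refl] inver[OF A_values[OF h]]])
    define t' where "t' i = s \<otimes> (if i \<le> j then t i else r)" for i
    have t'K: "t' i \<in> K" for i unfolding t'_def using sK tK rK by (auto intro: mult)
    have act_t': "act x (t' i) = act y (if i \<le> j then t i else r)" for i
      unfolding t'_def using tK rK by (intro act_s) auto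
    have act_t'_g: "act x (t' i \<otimes> g \<beta>) = act y ((if i \<le> j then t i else r) \<otimes> g \<beta>)"
      if "g \<in> A" for i g \<beta>
    proof -
      have "t' i \<otimes> g \<beta> = s \<otimes> ((if i \<le> j then t i else r) \<otimes> g \<beta>)"
        unfolding t'_def using car sK tK rK A_values[OF that] by (simp add: m_assoc)
      moreover have "(if i \<le> j then t i else r) \<otimes> g \<beta> \<in> K"
        using tK rK A_values[OF that] by (auto intro: mult)
      ultimately show ?thesis using act_s by simp
    qed
    have step: "dist (act y (r \<otimes> g (\<beta> |\<union>| \<alpha>))) (act y (t j \<otimes> g \<beta>)) < \<delta>"
      if g: "g \<in> A" and \<beta>: "\<beta> |\<subseteq>| M" for g \<beta>
    proof -
      have "\<beta> |\<inter>| \<alpha> = {||}"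
        using N \<beta> \<alpha>(2) by fastforce
      moreover have "t j \<in> T" using t by simp
      ultimately obtain g' where g': "g' \<in> A'"
        "g' \<alpha> = t j \<otimes> (inv (h \<alpha>) \<otimes> g (\<beta> |\<union>| \<alpha>) \<otimes> inv (g \<beta>)) \<otimes> inv (t j)"
        using A'_deriv g \<beta> by blast
      note cs = car[OF tK[OF order_refl]] car[OF A_values[OF h]] car[OF A_values[OF g]]
      have g'c: "g' \<alpha> \<in> carrier G" unfolding g'(2) using cs by simp
      have "r \<otimes> g (\<beta> |\<union>| \<alpha>) = g' \<alpha> \<otimes> (t j \<otimes> g \<beta>)"
        unfolding g'(2) r_def using cs by (simp add: word_simps)
      then have "act y (r \<otimes> g (\<beta> |\<union>| \<alpha>)) = act (act y (g' \<alpha>)) (t j \<otimes> g \<beta>)"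
        using act_act[OF y g'c] cs by simp
      moreover have "t j \<otimes> g \<beta> \<in> E"
        unfolding E_def using \<open>t j \<in> T\<close> g \<beta> by force
      moreover have "dist (act y (g' \<alpha>)) y < \<eta>"
        using near g'(1) unfolding y_def by blast
      ultimately show ?thesis
        using cont act_closed[OF y g'c] y by simp
    qed
    have "\<exists>\<gamma>. \<gamma> |\<subseteq>| M |\<union>| N \<and> (i < i' \<longrightarrow> \<gamma> \<noteq> {||}) \<and>
        (\<forall>g\<in>A. dist (act x (t' i' \<otimes> g \<gamma>)) (act x (t' i)) \<le> real (i' - i) * \<delta>)"
      if "i \<le> i'" "i' \<le> Suc j" for i i'
    proof -
      have "i' \<le> j \<or> i' = Suc j \<and> i = Suc j \<or> i' = Suc j \<and> i \<le> j"
        using that by linarith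
      then consider "i' \<le> j" | "i' = Suc j" "i = Suc j" | "i' = Suc j" "i \<le> j"
        by blast
      then show ?thesis
      proof cases
        case 1
        then obtain \<beta> where "\<beta> |\<subseteq>| M" "i < i' \<longrightarrow> \<beta> \<noteq> {||}"
          "\<forall>g\<in>A. dist (act y (t i' \<otimes> g \<beta>)) (act y (t i)) \<le> real (i' - i) * \<delta>"
          using chain \<open>i \<le> i'\<close> by blast
        then show ?thesis
          using 1 \<open>i \<le> i'\<close> act_t'_g act_t' by (intro exI[of _ \<beta>]) auto
      next
        case 2
        then show ?thesis
          using car[OF t'K] by (intro exI[of _ "{||}"]) (auto simp: A_empty)
      next
        case 3
        then obtain \<beta> where \<beta>: "\<beta> |\<subseteq>| M"
          and close: "\<forall>g\<in>A. dist (act y (t j \<otimes> g \<beta>)) (act y (t i)) \<le> real (j - i) * \<delta>"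
          using chain by blast
        show ?thesis
        proof (intro exI[of _ "\<beta> |\<union>| \<alpha>"] conjI impI ballI)
          show "\<beta> |\<union>| \<alpha> |\<subseteq>| M |\<union>| N" using \<beta> \<alpha>(2) by blast
          show "\<beta> |\<union>| \<alpha> \<noteq> {||}" using \<alpha>(1) by blast
          fix g assume g: "g \<in> A"
          have "dist (act y (r \<otimes> g (\<beta> |\<union>| \<alpha>))) (act y (t i)) \<le> \<delta> + real (j - i) * \<delta>"
            using dist_triangle[of "act y (r \<otimes> g (\<beta> |\<union>| \<alpha>))" "act y (t i)" "act y (t j \<otimes> g \<beta>)"]
              step[OF g \<beta>] bspec[OF close g] by linarith
          also have "\<dots> = real (i' - i) * \<delta>"
            using 3 by (simp add: Suc_diff_le algebra_simps)
          finally show "dist (act x (t' i' \<otimes> g (\<beta> |\<union>| \<alpha>))) (act x (t' i)) \<le> real (i' - i) * \<delta>"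
            using 3 act_t'_g[OF g] act_t' by simp
        qed
      qed
    qed
    moreover have "t' i \<in> T'" if "i \<le> Suc j" for i
    proof (cases "i \<le> j")
      case True
      then show ?thesis using t s unfolding t'_def T'_def by force
    next
      case False
      have "(s, t j, \<alpha>) \<in> S \<times> T \<times> fset (fPow N)" using s t \<alpha>(2) by simp
      then show ?thesis using False unfolding t'_def T'_def r_def by force
    qed
    ultimately show "\<exists>t. (\<forall>i\<le>Suc j. t i \<in> T') \<and> (\<forall>i i'. i \<le> i' \<longrightarrow> i' \<le> Suc j \<longrightarrow>
      (\<exists>\<alpha>. \<alpha> |\<subseteq>| M |\<union>| N \<and> (i < i' \<longrightarrow> \<alpha> \<noteq> {||}) \<and>
        (\<forall>g\<in>A. dist (act x (t i' \<otimes> g \<alpha>)) (act x (t i)) \<le> real (i' - i) * \<delta>)))"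
      by blast
  qed
qed

text \<open>A chain longer than the number of small balls covering the space contains two close
points \<open>y\<^sub>i\<close> and \<open>y\<^sub>i'\<close>; then all \<open>g \<alpha>\<close> move \<open>y\<^sub>i'\<close> close to \<open>y\<^sub>i\<close>, hence close to itself.\<close>

lemma recurrent_if_derived_recurrent:
  assumes K: "subgroup K G" and A: "finite A"
    and A_values: "\<And>g \<alpha>. g \<in> A \<Longrightarrow> g \<alpha> \<in> K" and A_empty: "\<And>g. g \<in> A \<Longrightarrow> g {||} = \<one>"
    and h: "h \<in> A"
    and derived: "\<And>T M. finite T \<Longrightarrow> T \<subseteq> K \<Longrightarrow> \<exists>A'. recurrent G K X act A' \<and>
      (\<forall>t\<in>T. \<forall>g\<in>A. \<forall>\<beta>. \<beta> |\<subseteq>| M \<longrightarrow> (\<exists>g'\<in>A'. \<forall>\<alpha>. \<beta> |\<inter>| \<alpha> = {||} \<longrightarrow>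
        g' \<alpha> = t \<otimes> (inv (h \<alpha>) \<otimes> g (\<beta> |\<union>| \<alpha>) \<otimes> inv (g \<beta>)) \<otimes> inv t))"
  shows "recurrent G K X act A"
  unfolding recurrent_def
proof (intro allI impI)
  fix \<epsilon> :: real and H :: "nat fset" assume "\<epsilon> > 0"
  have car: "k \<in> carrier G" if "k \<in> K" for k
    by (rule subgroup.mem_carrier[OF K that])
  obtain k where k: "\<And>y :: nat \<Rightarrow> 'x. (\<And>i. i \<le> k \<Longrightarrow> y i \<in> X) \<Longrightarrow>
      \<exists>i i'. i < i' \<and> i' \<le> k \<and> dist (y i) (y i') < \<epsilon> / 2"
    using compact_pigeonhole[OF half_gt_zero[OF \<open>\<epsilon> > 0\<close>]] by blast
  \<comment> \<open>At most \<open>k\<close> errors of size \<open>\<delta>\<close> accumulate along the chain.\<close>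
  define \<delta> where "\<delta> = \<epsilon> / (2 * real (Suc k))"
  have \<delta>: "\<delta> > 0" and k\<delta>: "real k * \<delta> \<le> \<epsilon> / 2"
    using \<open>\<epsilon> > 0\<close> by (auto simp: \<delta>_def field_simps)
  have "\<exists>M T. (\<forall>m n. m |\<in>| H \<longrightarrow> n |\<in>| M \<longrightarrow> m < n) \<and> finite T \<and> T \<subseteq> K \<and>
    (\<forall>x\<in>X. \<exists>t. (\<forall>i\<le>k. t i \<in> T) \<and> (\<forall>i i'. i \<le> i' \<longrightarrow> i' \<le> k \<longrightarrow>
      (\<exists>\<alpha>. \<alpha> |\<subseteq>| M \<and> (i < i' \<longrightarrow> \<alpha> \<noteq> {||}) \<and>
        (\<forall>g\<in>A. dist (act x (t i' \<otimes> g \<alpha>)) (act x (t i)) \<le> real (i' - i) * \<delta>))))"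
    by (rule chain_of_returns[OF K A _ _ h _ \<delta>]) (fact A_values A_empty derived)+
  then obtain M T where M: "\<forall>m n. m |\<in>| H \<longrightarrow> n |\<in>| M \<longrightarrow> m < n" and T: "finite T" "T \<subseteq> K"
    and chain: "\<forall>x\<in>X. \<exists>t. (\<forall>i\<le>k. t i \<in> T) \<and> (\<forall>i i'. i \<le> i' \<longrightarrow> i' \<le> k \<longrightarrow>
      (\<exists>\<alpha>. \<alpha> |\<subseteq>| M \<and> (i < i' \<longrightarrow> \<alpha> \<noteq> {||}) \<and>
        (\<forall>g\<in>A. dist (act x (t i' \<otimes> g \<alpha>)) (act x (t i)) \<le> real (i' - i) * \<delta>)))"
    by (elim exE conjE) (rule that)
  show "\<exists>N S. (\<forall>m n. m |\<in>| H \<longrightarrow> n |\<in>| N \<longrightarrow> m < n) \<and> finite S \<and> S \<subseteq> K \<and>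
     (\<forall>x\<in>X. \<exists>\<alpha> s. \<alpha> \<noteq> {||} \<and> \<alpha> |\<subseteq>| N \<and> s \<in> S \<and>
       (\<forall>g\<in>A. dist (act (act x s) (g \<alpha>)) (act x s) < \<epsilon>))"
  proof (rule exI[of _ M], rule exI[of _ T], intro conjI ballI M T)
    fix x assume x: "x \<in> X"
    obtain t where t: "\<forall>i\<le>k. t i \<in> T" and ret: "\<forall>i i'. i \<le> i' \<longrightarrow> i' \<le> k \<longrightarrow>
      (\<exists>\<alpha>. \<alpha> |\<subseteq>| M \<and> (i < i' \<longrightarrow> \<alpha> \<noteq> {||}) \<and>
        (\<forall>g\<in>A. dist (act x (t i' \<otimes> g \<alpha>)) (act x (t i)) \<le> real (i' - i) * \<delta>))"
      using bspec[OF chain x] by (elim exE conjE) (rule that)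
    have tK: "t i \<in> K" if "i \<le> k" for i using t that T(2) by blast
    obtain i i' where i: "i < i'" "i' \<le> k" and close: "dist (act x (t i)) (act x (t i')) < \<epsilon> / 2"
      using k[of "\<lambda>i. act x (t i)"] act_closed[OF x car[OF tK]] by blast
    obtain \<alpha> where \<alpha>: "\<alpha> |\<subseteq>| M" "\<alpha> \<noteq> {||}"
      and near: "\<forall>g\<in>A. dist (act x (t i' \<otimes> g \<alpha>)) (act x (t i)) \<le> real (i' - i) * \<delta>"
      using ret[rule_format, OF less_imp_le[OF i(1)] i(2)] i(1) by blast
    have "dist (act (act x (t i')) (g \<alpha>)) (act x (t i')) < \<epsilon>" if g: "g \<in> A" for g
    proof -
      have "act (act x (t i')) (g \<alpha>) = act x (t i' \<otimes> g \<alpha>)"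
        by (rule act_act[OF x car[OF tK[OF i(2)]] car[OF A_values[OF g]]])
      moreover have "real (i' - i) * \<delta> \<le> real k * \<delta>"
        using i \<delta> by (intro mult_right_mono) auto
      ultimately show ?thesis
        using dist_triangle[of "act x (t i' \<otimes> g \<alpha>)" "act x (t i')" "act x (t i)"]
          bspec[OF near g] close k\<delta> by simp
    qed
    then show "\<exists>\<alpha> s. \<alpha> \<noteq> {||} \<and> \<alpha> |\<subseteq>| M \<and> s \<in> T \<and>
       (\<forall>g\<in>A. dist (act (act x s) (g \<alpha>)) (act x s) < \<epsilon>)"
      using \<alpha> t i(2) by blast
  qed
qed

lemma recurrent_trivial:
  assumes K: "subgroup K G" and A: "\<And>g \<alpha>. g \<in> A \<Longrightarrow> g \<alpha> = \<one>"
  shows "recurrent G K X act A"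
  unfolding recurrent_def
proof (intro allI impI)
  fix \<epsilon> :: real and H :: "nat fset" assume "\<epsilon> > 0"
  obtain n where "\<forall>m\<in>fset H. m < n"
    using finite_nat_set_iff_bounded[of "fset H"] by auto
  then show "\<exists>N S. (\<forall>m n. m |\<in>| H \<longrightarrow> n |\<in>| N \<longrightarrow> m < n) \<and> finite S \<and> S \<subseteq> K \<and>
     (\<forall>x\<in>X. \<exists>\<alpha> s. \<alpha> \<noteq> {||} \<and> \<alpha> |\<subseteq>| N \<and> s \<in> S \<and>
       (\<forall>g\<in>A. dist (act (act x s) (g \<alpha>)) (act x s) < \<epsilon>))"
    using \<open>\<epsilon> > 0\<close> subgroup.one_closed[OF K]
    by (intro exI[of _ "{|n|}"] exI[of _ "{\<one>}"]) (auto simp: A act_one)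
qed

text \<open>Removing the identity map from a system lets every remaining member have an exact level.\<close>

lemma recurrent_remove_identity:
  assumes K: "subgroup K G" and "recurrent G K X act (A - {\<lambda>_. \<one>})"
  shows "recurrent G K X act A"
  unfolding recurrent_def
proof (intro allI impI)
  fix \<epsilon> :: real and H :: "nat fset" assume "\<epsilon> > 0"
  obtain N S where N: "\<And>m n. m |\<in>| H \<Longrightarrow> n |\<in>| N \<Longrightarrow> m < n" and S: "finite S" "S \<subseteq> K"
    and ret: "\<And>x. x \<in> X \<Longrightarrow> \<exists>\<alpha> s. \<alpha> \<noteq> {||} \<and> \<alpha> |\<subseteq>| N \<and> s \<in> S \<and>
       (\<forall>g\<in>A - {\<lambda>_. \<one>}. dist (act (act x s) (g \<alpha>)) (act x s) < \<epsilon>)"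
    using recurrentE[OF assms(2) \<open>\<epsilon> > 0\<close>, of H] by blast
  have "act (act x s) \<one> = act x s" if "x \<in> X" "s \<in> S" for x s
    using that S(2) by (intro act_one act_closed subgroup.mem_carrier[OF K]) auto
  then have "\<exists>\<alpha> s. \<alpha> \<noteq> {||} \<and> \<alpha> |\<subseteq>| N \<and> s \<in> S \<and>
       (\<forall>g\<in>A. dist (act (act x s) (g \<alpha>)) (act x s) < \<epsilon>)" if "x \<in> X" for x
    using ret[OF that] that \<open>\<epsilon> > 0\<close> by (metis DiffI dist_self singletonD)
  then show "\<exists>N S. (\<forall>m n. m |\<in>| H \<longrightarrow> n |\<in>| N \<longrightarrow> m < n) \<and> finite S \<and> S \<subseteq> K \<and>
     (\<forall>x\<in>X. \<exists>\<alpha> s. \<alpha> \<noteq> {||} \<and> \<alpha> |\<subseteq>| N \<and> s \<in> S \<and>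
       (\<forall>g\<in>A. dist (act (act x s) (g \<alpha>)) (act x s) < \<epsilon>))"
    using N S by blast
qed

end

section \<open>Systems of VIP maps\<close>

context
  fixes G :: "('a, 'b) monoid_scheme" (structure) and Gf :: "nat \<Rightarrow> 'a set" and D :: nat
  assumes group: "group G" and filt: "prefiltration G Gf" and length: "Gf D = {\<one>}"
begin

interpretation group G by (rule group)
interpretation maps: group "map_group G" using group by simp

abbreviation V :: "nat \<Rightarrow> (nat fset \<Rightarrow> 'a) set" where
  "V l \<equiv> VIP G (\<lambda>i. Gf (i + l))"

lemma VIP_polynomial: "g \<in> V l \<Longrightarrow> g \<in> poly_upto G Gf n l"
  using poly_upto_if_polynomial_map[OF group filt _ refl] unfolding VIP_def by blast

lemma VIP_if_polynomial: "g \<in> poly_upto G Gf D l \<Longrightarrow> g {||} = \<one> \<Longrightarrow> g \<in> V l"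
  using VIP_eq_poly_upto[OF group filt length, of D l] by simp

lemma VIP_empty: "g \<in> V l \<Longrightarrow> g {||} = \<one>"
  unfolding VIP_def by simp

text \<open>The derivative along \<open>\<beta>\<close> takes the value \<open>g \<beta>\<close> at the empty set; dividing by this constant makes
it a VIP map of the next level.\<close>

lemma VIP_derivative:
  assumes "g \<in> V l"
  shows "\<exists>u \<in> V (Suc l). \<forall>\<alpha>. \<beta> |\<inter>| \<alpha> = {||} \<longrightarrow> g (\<beta> |\<union>| \<alpha>) = g \<alpha> \<otimes> u \<alpha> \<otimes> g \<beta>"
proof -
  obtain Dg where Dg: "Dg \<in> poly_upto G Gf D (Suc l)"
    "\<And>\<alpha>. \<beta> |\<inter>| \<alpha> = {||} \<Longrightarrow> g (\<beta> |\<union>| \<alpha>) = g \<alpha> \<otimes> Dg \<alpha>"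
    using poly_upto_SucE[OF group filt VIP_polynomial[OF assms]] by blast
  have g_car: "g \<alpha> \<in> carrier G" for \<alpha>
    by (rule filtration_carrier[OF group filt poly_upto_values[OF group filt VIP_polynomial[OF assms, of 0]]])
  have Dg_car: "Dg \<alpha> \<in> carrier G" for \<alpha>
    by (rule filtration_carrier[OF group filt poly_upto_values[OF group filt Dg(1)]])
  have Dg_empty: "Dg {||} = g \<beta>"
    using Dg(2)[of "{||}"] VIP_empty[OF assms] Dg_car by simp
  have "inv (g \<beta>) \<in> Gf (Suc l)"
    using poly_upto_values[OF group filt Dg(1), of "{||}"]
      subgroup.m_inv_closed[OF prefiltration_subgroup[OF filt]] unfolding Dg_empty by blast
  then have "(\<lambda>_. inv (g \<beta>)) \<in> poly_upto G Gf D (Suc l)"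
    by (rule poly_upto_const[OF group filt])
  from subgroup.m_closed[OF prefiltration_subgroup[OF prefiltration_poly_upto[OF group filt]] Dg(1) this]
  have "(\<lambda>\<alpha>. Dg \<alpha> \<otimes> inv (g \<beta>)) \<in> poly_upto G Gf D (Suc l)"
    unfolding mult_map_group[OF group filt] .
  then have "(\<lambda>\<alpha>. Dg \<alpha> \<otimes> inv (g \<beta>)) \<in> V (Suc l)"
    by (rule VIP_if_polynomial) (use Dg_empty g_car in simp)
  moreover have "g (\<beta> |\<union>| \<alpha>) = g \<alpha> \<otimes> (Dg \<alpha> \<otimes> inv (g \<beta>)) \<otimes> g \<beta>" if "\<beta> |\<inter>| \<alpha> = {||}" for \<alpha>
    using Dg(2)[OF that] g_car Dg_car by (simp add: word_simps)
  ultimately show ?thesis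
    by (intro bexI[of _ "\<lambda>\<alpha>. Dg \<alpha> \<otimes> inv (g \<beta>)"]) simp_all
qed

lemma VIP_values:
  assumes "g \<in> V 0"
  shows "g \<beta> \<in> Gf 1"
proof -
  obtain Dg where Dg: "Dg \<in> poly_upto G Gf 0 (Suc 0)"
    "\<And>\<alpha>. \<beta> |\<inter>| \<alpha> = {||} \<Longrightarrow> g (\<beta> |\<union>| \<alpha>) = g \<alpha> \<otimes> Dg \<alpha>"
    using poly_upto_SucE[OF group filt VIP_polynomial[OF assms]] by blast
  have Dg1: "Dg {||} \<in> Gf (Suc 0)"
    by (rule poly_upto_values[OF group filt Dg(1)])
  then have "g \<beta> = Dg {||}"
    using Dg(2)[of "{||}"] VIP_empty[OF assms] filtration_carrier[OF group filt Dg1] by simp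
  then show ?thesis using Dg1 by simp
qed

text \<open>With \<open>T\<close> the constant map \<open>t\<close>, the left-hand side equals \<open>[p, inv T] u [u, inv T]\<close>. Constants in
the first group have degree one, so the first commutator gains a level.\<close>

lemma VIP_twist:
  assumes p: "p \<in> V l" and u: "u \<in> V (Suc l)" and t: "t \<in> Gf 1"
  shows "inv\<^bsub>map_group G\<^esub> p \<otimes>\<^bsub>map_group G\<^esub> (\<lambda>\<alpha>. t \<otimes> (p \<alpha> \<otimes> u \<alpha>) \<otimes> inv t) \<in> V (Suc l)"
proof -
  let ?P = "poly_upto G Gf D"
  note filtP = prefiltration_poly_upto[OF group filt, of D]
  note sub = prefiltration_subgroup[OF filtP]
  note pP = VIP_polynomial[OF p, of D] and uP = VIP_polynomial[OF u, of D]
  note car = poly_upto_carrier[OF group filt]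
  have "inv t \<in> Gf 1"
    by (rule subgroup.m_inv_closed[OF prefiltration_subgroup[OF filt] t])
  then have T: "(\<lambda>_. inv t) \<in> ?P 1"
    by (rule poly_upto_const[OF group filt])
  have tc: "t \<in> carrier G" by (rule filtration_carrier[OF group filt t])
  have pc: "p \<alpha> \<in> carrier G" and uc: "u \<alpha> \<in> carrier G" for \<alpha>
    using filtration_carrier[OF group filt poly_upto_values[OF group filt pP]]
      filtration_carrier[OF group filt poly_upto_values[OF group filt uP]] by auto
  have c1: "commutator (map_group G) p (\<lambda>_. inv t) \<in> ?P (Suc l)"
    using prefiltration_commutator[OF filtP pP T] by simp
  have c2: "commutator (map_group G) u (\<lambda>_. inv t) \<in> ?P (Suc l)"
    using subsetD[OF prefiltration_antimono[OF filtP] prefiltration_commutator[OF filtP uP T]] by simp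
  have eq: "inv\<^bsub>map_group G\<^esub> p \<otimes>\<^bsub>map_group G\<^esub> (\<lambda>\<alpha>. t \<otimes> (p \<alpha> \<otimes> u \<alpha>) \<otimes> inv t) =
    commutator (map_group G) p (\<lambda>_. inv t) \<otimes>\<^bsub>map_group G\<^esub> u \<otimes>\<^bsub>map_group G\<^esub>
    commutator (map_group G) u (\<lambda>_. inv t)" (is "?l = ?r")
    unfolding commutator_map_group[OF group filt car[OF pP] car[OF T]]
      commutator_map_group[OF group filt car[OF uP] car[OF T]]
      inv_map_group[OF group filt car[OF pP]] mult_map_group[OF group filt]
    using tc pc uc by (simp add: commutator_def word_simps)
  have "?l \<in> ?P (Suc l)"
    unfolding eq by (rule subgroup.m_closed[OF sub subgroup.m_closed[OF sub c1 uP] c2])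
  moreover have "?l {||} = \<one>"
    unfolding inv_map_group[OF group filt car[OF pP]] mult_map_group[OF group filt]
    using VIP_empty[OF p] VIP_empty[OF u] tc by simp
  ultimately show ?thesis by (rule VIP_if_polynomial)
qed

lemma VIP_trivial: "g \<in> V D \<Longrightarrow> g = (\<lambda>_. \<one>)"
  using poly_upto_values[OF group filt VIP_polynomial, of g D] length by (intro ext) blast

text \<open>The system needed to prolong chains. By the derivative formula,
\<open>inv (h \<alpha>) \<otimes> g (\<beta> |\<union>| \<alpha>) \<otimes> inv (g \<beta>)\<close> is \<open>inv (h \<alpha>) \<otimes> g \<alpha> \<otimes> u \<alpha>\<close> with \<open>u\<close> of higher level
than \<open>g\<close>, and conjugation by \<open>t\<close> also changes only higher levels. Disjointness of \<open>\<alpha>\<close> and \<open>\<beta>\<close> is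
required because derivatives are determined only there.\<close>

lemma derived_system:
  assumes A: "finite A" "A \<subseteq> V 0" "(\<lambda>_. \<one>) \<notin> A"
    and h: "h \<in> A" "h \<in> V L" "h \<notin> V (Suc L)" and L: "L < D"
    and top: "\<And>g. g \<in> A \<Longrightarrow> g \<notin> V (Suc L)"
    and T: "finite T" "T \<subseteq> Gf 1"
  obtains A' where "finite A'" "A' \<subseteq> V 0" "(A', A) \<in> system_order (map_group G) V D"
    and "\<forall>t\<in>T. \<forall>g\<in>A. \<forall>\<beta>. \<beta> |\<subseteq>| M \<longrightarrow> (\<exists>g'\<in>A'. \<forall>\<alpha>. \<beta> |\<inter>| \<alpha> = {||} \<longrightarrow>
        g' \<alpha> = t \<otimes> (inv (h \<alpha>) \<otimes> g (\<beta> |\<union>| \<alpha>) \<otimes> inv (g \<beta>)) \<otimes> inv t)"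
proof -
  note filtV = prefiltration_VIP[OF group filt length]
  note sub = prefiltration_subgroup[OF filtV]
  have anti: "x \<in> V i" if "x \<in> V j" "i \<le> j" for x i j
    using prefiltration_antimono[OF filtV that(2)] that(1) by (rule subsetD)
  have car: "g \<alpha> \<in> carrier G" if "g \<in> V 0" for g \<alpha>
    by (rule filtration_carrier[OF group filt VIP_values[OF that]])
  have h0: "h \<in> V 0" and hc: "\<And>\<alpha>. h \<alpha> \<in> carrier G"
    using h(1) A(2) car by auto
  have "\<exists>l u. g \<in> V l \<and> g \<notin> V (Suc l) \<and> u \<in> V (Suc l) \<and>
      (\<forall>\<alpha>. \<beta> |\<inter>| \<alpha> = {||} \<longrightarrow> g (\<beta> |\<union>| \<alpha>) = g \<alpha> \<otimes> u \<alpha> \<otimes> g \<beta>)" if "g \<in> A" for g \<beta>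
  proof -
    have "g \<in> V 0" "g \<notin> V D"
      using that A(2,3) VIP_trivial by auto
    then obtain l where "g \<in> V l" "g \<notin> V (Suc l)"
      using exact_level[of g V D] by blast
    then show ?thesis using VIP_derivative[of g l \<beta>] by blast
  qed
  then obtain lev u where lev: "\<And>g \<beta>. g \<in> A \<Longrightarrow> g \<in> V (lev g \<beta>)"
    "\<And>g \<beta>. g \<in> A \<Longrightarrow> g \<notin> V (Suc (lev g \<beta>))"
    and u: "\<And>g \<beta>. g \<in> A \<Longrightarrow> u g \<beta> \<in> V (Suc (lev g \<beta>))"
    and u_eq: "\<And>g \<beta> \<alpha>. g \<in> A \<Longrightarrow> \<beta> |\<inter>| \<alpha> = {||} \<Longrightarrow> g (\<beta> |\<union>| \<alpha>) = g \<alpha> \<otimes> u g \<beta> \<alpha> \<otimes> g \<beta>"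
    by metis
  define F where "F = (\<lambda>(t, g, \<beta>) \<alpha>. t \<otimes> (inv (h \<alpha>) \<otimes> g \<alpha> \<otimes> u g \<beta> \<alpha>) \<otimes> inv t)"
  define A' where "A' = F ` (T \<times> A \<times> fset (fPow M))"
  have twist: "inv\<^bsub>map_group G\<^esub> (inv\<^bsub>map_group G\<^esub> h \<otimes>\<^bsub>map_group G\<^esub> g) \<otimes>\<^bsub>map_group G\<^esub> F (t, g, \<beta>)
      \<in> V (Suc (lev g \<beta>)) \<and> F (t, g, \<beta>) \<in> V 0" if "t \<in> T" "g \<in> A" for t g \<beta>
  proof -
    have "lev g \<beta> \<le> L"
    proof (rule ccontr)
      assume "\<not> lev g \<beta> \<le> L"
      then have "Suc L \<le> lev g \<beta>" by simp
      from anti[OF lev(1)[OF that(2)] this] top[OF that(2)] show False by contradiction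
    qed
    define p where "p = inv\<^bsub>map_group G\<^esub> h \<otimes>\<^bsub>map_group G\<^esub> g"
    have p: "p \<in> V (lev g \<beta>)"
      unfolding p_def
      by (rule subgroup.m_closed[OF sub subgroup.m_inv_closed[OF sub anti[OF h(2) \<open>lev g \<beta> \<le> L\<close>]]
            lev(1)[OF that(2)]])
    have p_eq: "p = (\<lambda>\<alpha>. inv (h \<alpha>) \<otimes> g \<alpha>)"
      unfolding p_def inv_map_group[OF group filt subgroup.mem_carrier[OF sub h0]]
        mult_map_group[OF group filt] ..
    have F: "F (t, g, \<beta>) = (\<lambda>\<alpha>. t \<otimes> (p \<alpha> \<otimes> u g \<beta> \<alpha>) \<otimes> inv t)"
      unfolding F_def p_eq by simp
    have tG: "t \<in> Gf 1" using that(1) T(2) by blast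
    have q: "inv\<^bsub>map_group G\<^esub> p \<otimes>\<^bsub>map_group G\<^esub> F (t, g, \<beta>) \<in> V (Suc (lev g \<beta>))"
      unfolding F by (rule VIP_twist[OF p u[OF that(2)] tG])
    have "F (t, g, \<beta>) \<in> carrier (map_group G)"
    proof -
      have "F (t, g, \<beta>) \<alpha> \<in> carrier G" for \<alpha>
        unfolding F using car[OF anti[OF p le0]] car[OF anti[OF u[OF that(2)] le0]]
          filtration_carrier[OF group filt tG] by simp
      then show ?thesis by (simp add: PiE_def Pi_def)
    qed
    then have "F (t, g, \<beta>) = p \<otimes>\<^bsub>map_group G\<^esub> (inv\<^bsub>map_group G\<^esub> p \<otimes>\<^bsub>map_group G\<^esub> F (t, g, \<beta>))"
      by (rule maps.cancel_inv_right[OF subgroup.mem_carrier[OF sub p], symmetric])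
    moreover have "p \<otimes>\<^bsub>map_group G\<^esub> (inv\<^bsub>map_group G\<^esub> p \<otimes>\<^bsub>map_group G\<^esub> F (t, g, \<beta>)) \<in> V 0"
      by (rule subgroup.m_closed[OF sub anti[OF p le0] anti[OF q le0]])
    ultimately have "F (t, g, \<beta>) \<in> V 0" by simp
    with q show ?thesis unfolding p_def by blast
  qed
  have fin: "finite A'"
    unfolding A'_def using A(1) T(1) by simp
  have A'_V: "A' \<subseteq> V 0"
  proof
    fix g' assume "g' \<in> A'"
    then obtain t g \<beta> where "g' = F (t, g, \<beta>)" "t \<in> T" "g \<in> A"
      unfolding A'_def by auto
    then show "g' \<in> V 0" using twist by blast
  qed
  have ord: "(A', A) \<in> system_order (map_group G) V D"
  proof (rule system_order_descent[OF maps.is_group filtV A(1,2) h L top])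
    fix g' assume "g' \<in> A'"
    then obtain t g \<beta> where g': "g' = F (t, g, \<beta>)" "t \<in> T" "g \<in> A"
      unfolding A'_def by auto
    show "\<exists>g\<in>A. \<exists>l. g \<in> V l \<and> g \<notin> V (Suc l) \<and>
        inv\<^bsub>map_group G\<^esub> (inv\<^bsub>map_group G\<^esub> h \<otimes>\<^bsub>map_group G\<^esub> g) \<otimes>\<^bsub>map_group G\<^esub> g' \<in> V (Suc l)"
      unfolding g'(1)
      by (rule bexI[OF _ g'(3)], rule exI[of _ "lev g \<beta>"])
        (use lev[OF g'(3)] twist[OF g'(2,3)] in blast)
  qed
  have "\<exists>g'\<in>A'. \<forall>\<alpha>. \<beta> |\<inter>| \<alpha> = {||} \<longrightarrow>
      g' \<alpha> = t \<otimes> (inv (h \<alpha>) \<otimes> g (\<beta> |\<union>| \<alpha>) \<otimes> inv (g \<beta>)) \<otimes> inv t"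
    if "t \<in> T" "g \<in> A" "\<beta> |\<subseteq>| M" for t g \<beta>
  proof (intro bexI[of _ "F (t, g, \<beta>)"] allI impI)
    show "F (t, g, \<beta>) \<in> A'" unfolding A'_def using that by simp
    fix \<alpha> assume disj: "\<beta> |\<inter>| \<alpha> = {||}"
    have gc: "g \<gamma> \<in> carrier G" and uc: "u g \<beta> \<gamma> \<in> carrier G" for \<gamma>
      using car that(2) A(2) car[OF anti[OF u[OF that(2)] le0]] by auto
    have "inv (h \<alpha>) \<otimes> g (\<beta> |\<union>| \<alpha>) \<otimes> inv (g \<beta>) = inv (h \<alpha>) \<otimes> g \<alpha> \<otimes> u g \<beta> \<alpha>"
      unfolding u_eq[OF that(2) disj] using gc uc hc by (simp add: word_simps)
    then show "F (t, g, \<beta>) \<alpha> = t \<otimes> (inv (h \<alpha>) \<otimes> g (\<beta> |\<union>| \<alpha>) \<otimes> inv (g \<beta>)) \<otimes> inv t"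
      unfolding F_def by simp
  qed
  then show thesis
    using that[OF fin A'_V ord] by blast
qed

text \<open>PET induction. For a nontrivial system a member \<open>h\<close> of maximal level is chosen; the derived
systems precede it, hence are recurrent, and recurrence follows by focusing.\<close>

lemma recurrent_VIP:
  assumes action: "compact_action G X act" and "finite A" "A \<subseteq> V 0"
  shows "recurrent G (Gf 1) X act A"
  using wf_system_order[of "map_group G" V D] assms(2,3)
proof (induction A rule: wf_induct_rule)
  case (less A)
  interpret compact_action G X act by (rule action)
  note filtV = prefiltration_VIP[OF group filt length]
  have K: "subgroup (Gf 1) G" by (rule prefiltration_subgroup[OF filt])
  define B where "B = A - {\<lambda>_. \<one>}"
  have B: "finite B" "B \<subseteq> V 0" "(\<lambda>_. \<one>) \<notin> B"
    using less.prems unfolding B_def by auto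
  have one: "(\<lambda>_. \<one>) \<in> V l" for l
    using VIP_if_polynomial[OF poly_upto_const[OF group filt
          subgroup.one_closed[OF prefiltration_subgroup[OF filt]]]] by simp
  have "B \<inter> (V l - V (Suc l)) = A \<inter> (V l - V (Suc l))" for l
    using one unfolding B_def by blast
  then have weights: "level_weight (map_group G) V B = level_weight (map_group G) V A"
    unfolding level_weight_def by simp
  show ?case
  proof (rule recurrent_remove_identity[OF K], fold B_def)
    show "recurrent G (Gf 1) X act B"
    proof (cases "B = {}")
      case True
      then show ?thesis by (intro recurrent_trivial[OF K]) simp
    next
      case False
      let ?R = "{l. l < D \<and> (\<exists>g\<in>B. g \<in> V l \<and> g \<notin> V (Suc l))}"
      have level: "\<exists>l. l \<in> ?R \<and> g \<in> V l \<and> g \<notin> V (Suc l)" if "g \<in> B" for g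
      proof -
        have "g \<in> V 0" "g \<notin> V D"
          using that B(2,3) VIP_trivial by auto
        then show ?thesis
          using exact_level[of g V D] that by blast
      qed
      define L where "L = Max ?R"
      have "finite ?R" by simp
      have "?R \<noteq> {}" using False level by blast
      with \<open>finite ?R\<close> have "L \<in> ?R" unfolding L_def by (rule Max_in)
      then obtain h where L: "L < D" and h: "h \<in> B" "h \<in> V L" "h \<notin> V (Suc L)" by blast
      have top: "g \<notin> V (Suc L)" if g: "g \<in> B" for g
      proof
        assume *: "g \<in> V (Suc L)"
        obtain l where l: "l \<in> ?R" "g \<notin> V (Suc l)"
          using level[OF g] by blast
        have "l \<le> L" unfolding L_def by (rule Max_ge[OF \<open>finite ?R\<close> l(1)])
        then show False
          using subsetD[OF prefiltration_antimono[OF filtV, of "Suc l" "Suc L"] *] l(2) by simp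
      qed
      show ?thesis
      proof (rule recurrent_if_derived_recurrent[OF K B(1) _ _ h(1)])
        show "g \<alpha> \<in> Gf 1" if "g \<in> B" for g \<alpha>
          using VIP_values that B(2) by blast
        show "g {||} = \<one>" if "g \<in> B" for g
          using VIP_empty that B(2) by blast
        fix T M assume T: "finite T" "T \<subseteq> Gf 1"
        obtain A' where A': "finite A'" "A' \<subseteq> V 0" "(A', B) \<in> system_order (map_group G) V D"
          and deriv: "\<forall>t\<in>T. \<forall>g\<in>B. \<forall>\<beta>. \<beta> |\<subseteq>| M \<longrightarrow> (\<exists>g'\<in>A'. \<forall>\<alpha>. \<beta> |\<inter>| \<alpha> = {||} \<longrightarrow>
            g' \<alpha> = t \<otimes> (inv (h \<alpha>) \<otimes> g (\<beta> |\<union>| \<alpha>) \<otimes> inv (g \<beta>)) \<otimes> inv t)"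
          using derived_system[OF B h L top T, of M] by blast
        have "(A', A) \<in> system_order (map_group G) V D"
          using A'(3) unfolding system_order_def in_inv_image weights .
        then have "recurrent G (Gf 1) X act A'"
          by (rule less.IH[OF _ A'(1,2)])
        with deriv show "\<exists>A'. recurrent G (Gf 1) X act A' \<and>
          (\<forall>t\<in>T. \<forall>g\<in>B. \<forall>\<beta>. \<beta> |\<subseteq>| M \<longrightarrow> (\<exists>g'\<in>A'. \<forall>\<alpha>. \<beta> |\<inter>| \<alpha> = {||} \<longrightarrow>
            g' \<alpha> = t \<otimes> (inv (h \<alpha>) \<otimes> g (\<beta> |\<union>| \<alpha>) \<otimes> inv (g \<beta>)) \<otimes> inv t))"
          by blast
      qed
    qed
  qed
qed

end

section \<open>The nilpotent Hales--Jewett theorem\<close>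

theorem theorem3p6:
  fixes G :: "('a, 'b) monoid_scheme"
    and Gf :: "nat \<Rightarrow> 'a set"
    and X :: "'x::metric_space set"
    and act :: "'x \<Rightarrow> 'a \<Rightarrow> 'x"
    and A :: "(nat fset \<Rightarrow> 'a) set"
    and \<epsilon> :: real
    and H :: "nat fset"
  assumes "group G"
    and "prefiltration G Gf"
    and "has_finite_length G Gf"
    and "Gf 0 = carrier G"
    and "compact X"
    and "right_action_by_homeomorphisms G X act"
    and "finite A" and "A \<subseteq> VIP G Gf"
    and "\<epsilon> > 0"
    and "H \<noteq> {||}"
  shows "\<exists>N S. N \<noteq> {||} \<and> fset_before H N \<and> finite S \<and> S \<subseteq> carrier G \<and>
    (\<forall>x\<in>X. \<exists>\<alpha> s. \<alpha> \<noteq> {||} \<and> \<alpha> |\<subseteq>| N \<and> s \<in> S \<and>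
      (\<forall>g\<in>A. dist (act (act x s) (g \<alpha>)) (act x s) < \<epsilon>))"
proof -
  obtain D where D: "Gf D = {\<one>\<^bsub>G\<^esub>}"
    using assms(3) unfolding has_finite_length_def by blast
  have "compact_action G X act"
    using assms(1,5,6) by (simp add: compact_action_def compact_action_axioms_def)
  then have "recurrent G (Gf 1) X act A"
    using recurrent_VIP[OF assms(1,2) D _ assms(7)] assms(8) by simp
  from recurrentE[OF this assms(9), of H] obtain N S where
    N: "\<And>m n. m |\<in>| H \<Longrightarrow> n |\<in>| N \<Longrightarrow> m < n" and S: "finite S" "S \<subseteq> Gf 1"
    and ret: "\<And>x. x \<in> X \<Longrightarrow> \<exists>\<alpha> s. \<alpha> \<noteq> {||} \<and> \<alpha> |\<subseteq>| N \<and> s \<in> S \<and>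
       (\<forall>g\<in>A. dist (act (act x s) (g \<alpha>)) (act x s) < \<epsilon>)"
    by blast
  let ?N = "finsert (Suc (fMax H)) N"
  have "fMin ?N |\<in>| ?N" by (rule fMin_in) simp
  then have "fMax H < fMin ?N"
    using N[OF fMax_in[OF assms(10)]] by auto
  then have "fset_before H ?N"
    by (simp add: fset_before_def)
  moreover have "S \<subseteq> carrier G"
    using S(2) subgroup.subset[OF prefiltration_subgroup[OF assms(2)]] by (rule subset_trans)
  moreover have "\<exists>\<alpha> s. \<alpha> \<noteq> {||} \<and> \<alpha> |\<subseteq>| ?N \<and> s \<in> S \<and>
      (\<forall>g\<in>A. dist (act (act x s) (g \<alpha>)) (act x s) < \<epsilon>)" if "x \<in> X" for x
    using ret[OF that] by blast
  ultimately show ?thesis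
    using S(1) by blast
qed

end
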